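(* Let $\lambda>0$, $\theta\in\mathbb{R}$, $\beta\in\mathcal{B}_2\setminus\mathcal{B}_1$, and let $\rho$ be a regularizing function for $\beta$ with associated deformed sequence $\beta(\Lambda)$, singular part $r(\Lambda)$ and constant $\kappa$. Put $$\beta_{\mathrm r}(\Lambda)=\{\beta_j(\Lambda)-\lambda r(\Lambda)-\lambda\theta\}_{j=1}^{+\infty},\qquad N(\Lambda)=e^{-\lambda(r(\Lambda)+\theta)^2/4}\prod_{j=1}^{+\infty}\sqrt{\beta_j(\Lambda)/\beta_{\mathrm r,j}(\Lambda)}.$$ Then the regularization and renormalization of $Z(\lambda,\beta)$ can be performed compatibly with those of $\Phi(s,\beta)$ through the integral operator $\mathrm{T}$, i.e. for all sufficiently large $\Lambda$: 1. the regularized function $Z(\lambda,\beta(\Lambda))$ exists and $Z(\lambda,\beta(\Lambda))=\mathrm{T}\big(\Phi(\,\cdot\,,\beta(\Lambda))\big)(\lambda)$; 2. the renormalized function $Z(\lambda,\beta_{\mathrm r}(\Lambda))N(\Lambda)$ exists and $$Z(\lambda,\beta_{\mathrm r}(\Lambda))\,N(\Lambda)=\mathrm{T}\Big(\Phi(\,\cdot\,,\beta(\Lambda))\,e^{-i(\cdot)(r(\Lambda)+\theta)/2}\Big)(\lambda);$$ 3. the limit $Z(\lambda,\beta,\theta)=\lim_{\Lambda\to+\infty}Z(\lambda,\beta_{\mathrm r}(\Lambda))N(\Lambda)$ exists and equals $\mathrm{T}\big(\Phi(\,\cdot\,,\beta,\theta)\big)(\lambda)$, where $\Phi(s,\beta,\theta)=\lim_{\Lambda\to+\infty}\Phi(s,\beta(\Lambda))e^{-is(r(\Lambda)+\theta)/2}=f(s)\exp\big(-\tfrac{i}{2}(s\theta+g_{\mathrm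 r}(s))\big)$; explicitly, $$Z(\lambda,\beta,\theta)=\frac{1}{\sqrt{4\pi\lambda}}\int_{\mathbb{R}}\mathrm{d}s\,e^{-s^2/(4\lambda)}f(s)\cos\big(s\theta/2+g_{\mathrm r}(s)/2\big),$$ with $$f(s)=\prod_{j=1}^{+\infty}\Big(1+\frac{s^2}{\beta_j^2}\Big)^{-1/4},\qquad g_{\mathrm r}(s)=-s\kappa+s^3\int_0^1\mathrm{d}t\,\sum_{j=1}^{+\infty}\frac{t^2\beta_j^{-3}}{1+s^2t^2/\beta_j^2}.$$ Furthermore, for fixed $\lambda>0$ and $\beta$, $Z(\lambda,\beta,\theta)\neq0$ for almost all $\theta\in\mathbb{R}$.
   Context: For $k\in\mathbb{N}=\{1,2,\dots\}$, $\mathcal{B}_k$ is the set of real sequences $\beta=\{\beta_j\}_{j=1}^{+\infty}$ with $\beta_j>0$ for all $j$ and $b_k(\beta)=\sum_{j=1}^{+\infty}\beta_j^{-k}<+\infty$. For $n\in\mathbb{N}$, $s\in\mathbb{R}$, $\lambda\ge0$, $$\Phi_n(s,\beta)=\prod_{j=1}^{n}\int_{\mathbb{R}}\frac{\mathrm{d}a_j}{\sqrt{\pi/\beta_j}}\,e^{-\beta_j a_j^2+isa_j^2},$$ $$Z_n(\lambda,\beta)=\Big(\prod_{j=1}^{n}\int_{\mathbb{R}}\frac{\mathrm{d}a_j}{\sqrt{\pi/\beta_j}}\Big)\exp\Big(-\sum_{j=1}^n\beta_ja_j^2-\lambda\Big(\sum_{j=1}^na_j^2\Big)^2\Big),$$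 and $\Phi(s,\beta)$, $Z(\lambda,\beta)$ denote the limits as $n\to+\infty$ when they exist. The integral operator $\mathrm{T}$ is $\mathrm{T}(u)(\lambda)=\frac{1}{\sqrt{4\pi\lambda}}\int_{\mathbb{R}}\mathrm{d}s\,e^{-s^2/(4\lambda)}u(s)$. Regularizing function: for $\beta\in\mathcal{B}_2\setminus\mathcal{B}_1$ it is a continuous function $\rho:[0,+\infty)\to[0,1]$ with $\rho(0)=1$ such that, putting $\beta_j(\Lambda)=\beta_j/\rho\big(\sqrt{\beta_j/\Lambda}\big)$ and $\beta(\Lambda)=\{\beta_j(\Lambda)\}_{j\ge1}$, for all $\Lambda$ larger than some fixed value one has $$\sum_{j=1}^{+\infty}\frac{1}{\beta_j(\Lambda)}=r(\Lambda)+\kappa+o(1)<+\infty\quad(\Lambda\to+\infty),$$ where $r(\Lambda)$ is a real function (the singular part) tending to $+\infty$ as $\Lambda\to+\infty$, and $\kappa\in\mathbb{R}$ does not depend on $\Lambda$. If $\rho(\sqrt{\beta_j/\Lambda})=0$, then $1/\beta_j(\Lambda)=0$ by convention, and the $j$-th coordinate is dropped from all integrals (i.e. $a_j=0$ and the $j$-th normalized integration is omitted). Since entries of $\beta_{\mathrm r}(\Lambda)$ may be non-positive, the product $Z(\lambda,\beta_{\mathrm r}(\Lambda))N(\Lambda)$ is understood with the square-root normalizations $\sqrt{\beta_{\mathrm r,j}(\Lambda)}$ cancelled between the two factors, that is, as $$\lim_{n\to+\infty}e^{-\lambda(r(\Lambda)+\theta)^2/4}\Big(\prod_{j=1}^{n}\int_{\mathbb{R}}\frac{\mathrm{d}a_j}{\sqrt{\pi/\beta_j(\Lambda)}}\Big)\exp\Big(-\sum_{j=1}^n\beta_{\mathrm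 r,j}(\Lambda)a_j^2-\lambda\Big(\sum_{j=1}^na_j^2\Big)^2\Big).$$ *)

theory Defs
  imports "HOL-Analysis.Analysis" "HOL-Library.Landau_Symbols"
begin

text \<open>Sequences \<open>(\<beta>\<^sub>1, \<beta>\<^sub>2, \<dots>)\<close> are functions on \<^typ>\<open>nat\<close>, with \<open>\<beta> j\<close> standing for the entry of
  index \<open>j + 1\<close>; so the first \<open>n\<close> entries are those with index in \<open>{..<n}\<close>.\<close>

definition seqs :: "nat \<Rightarrow> (nat \<Rightarrow> real) set" where
  "seqs k = {\<beta>. (\<forall>j. \<beta> j > 0) \<and> summable (\<lambda>j. 1 / \<beta> j ^ k)}"

text \<open>A set \<open>J\<close> records which coordinates are kept; coordinates outside \<open>J\<close> are omitted from all
  products and integrals. \<open>J = UNIV\<close> gives the undropped quantities.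

  Both the Bochner integral and \<^const>\<open>Lim\<close> are total, so each quantity comes with a predicate
  saying that the integrals and limits defining it exist.\<close>

definition Phi_integrand :: "(nat \<Rightarrow> real) \<Rightarrow> real \<Rightarrow> nat \<Rightarrow> real \<Rightarrow> complex" where
  "Phi_integrand \<beta> s j a =
     exp (- complex_of_real (\<beta> j * a\<^sup>2) + \<i> * complex_of_real (s * a\<^sup>2)) / complex_of_real (sqrt (pi / \<beta> j))"

definition Phi_n :: "nat set \<Rightarrow> nat \<Rightarrow> real \<Rightarrow> (nat \<Rightarrow> real) \<Rightarrow> complex" where
  "Phi_n J n s \<beta> = (\<Prod>j\<in>{..<n} \<inter> J. LINT a|lborel. Phi_integrand \<beta> s j a)"

definition Phi :: "nat set \<Rightarrow> real \<Rightarrow> (nat \<Rightarrow> real) \<Rightarrow> complex" where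
  "Phi J s \<beta> = lim (\<lambda>n. Phi_n J n s \<beta>)"

definition Phi_exists :: "nat set \<Rightarrow> real \<Rightarrow> (nat \<Rightarrow> real) \<Rightarrow> bool" where
  "Phi_exists J s \<beta> \<longleftrightarrow>
     (\<forall>j\<in>J. integrable lborel (Phi_integrand \<beta> s j)) \<and> convergent (\<lambda>n. Phi_n J n s \<beta>)"

definition Z_integrand :: "nat set \<Rightarrow> nat \<Rightarrow> real \<Rightarrow> (nat \<Rightarrow> real) \<Rightarrow> (nat \<Rightarrow> real) \<Rightarrow> real" where
  "Z_integrand J n lam \<beta> a =
     exp (- (\<Sum>j\<in>{..<n} \<inter> J. \<beta> j * (a j)\<^sup>2) - lam * (\<Sum>j\<in>{..<n} \<inter> J. (a j)\<^sup>2)\<^sup>2)"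

text \<open>The sequence \<open>\<nu>\<close> in the normalization \<open>da\<^sub>j / sqrt (\<pi> / \<nu>\<^sub>j)\<close> is kept separate from the sequence
  \<open>\<beta>\<close> in the exponent: they coincide in \<open>Z\<close>, but differ in the renormalized function, whose
  exponent may have non-positive coefficients.\<close>

definition Z_gen_n :: "nat set \<Rightarrow> nat \<Rightarrow> (nat \<Rightarrow> real) \<Rightarrow> real \<Rightarrow> (nat \<Rightarrow> real) \<Rightarrow> real" where
  "Z_gen_n J n \<nu> lam \<beta> =
     (\<Prod>j\<in>{..<n} \<inter> J. 1 / sqrt (pi / \<nu> j)) *
     (LINT a|Pi\<^sub>M ({..<n} \<inter> J) (\<lambda>_. lborel). Z_integrand J n lam \<beta> a)"

definition Z_n :: "nat set \<Rightarrow> nat \<Rightarrow> real \<Rightarrow> (nat \<Rightarrow> real) \<Rightarrow> real" where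
  "Z_n J n lam \<beta> = Z_gen_n J n \<beta> lam \<beta>"

definition Z :: "nat set \<Rightarrow> real \<Rightarrow> (nat \<Rightarrow> real) \<Rightarrow> real" where
  "Z J lam \<beta> = lim (\<lambda>n. Z_n J n lam \<beta>)"

definition Z_exists :: "nat set \<Rightarrow> real \<Rightarrow> (nat \<Rightarrow> real) \<Rightarrow> bool" where
  "Z_exists J lam \<beta> \<longleftrightarrow>
     (\<forall>n. integrable (Pi\<^sub>M ({..<n} \<inter> J) (\<lambda>_. lborel)) (Z_integrand J n lam \<beta>)) \<and>
     convergent (\<lambda>n. Z_n J n lam \<beta>)"

definition T_integrand :: "(real \<Rightarrow> complex) \<Rightarrow> real \<Rightarrow> real \<Rightarrow> complex" where
  "T_integrand u lam s = complex_of_real (exp (- s\<^sup>2 / (4 * lam))) * u s"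

definition T_op :: "(real \<Rightarrow> complex) \<Rightarrow> real \<Rightarrow> complex" where
  "T_op u lam = complex_of_real (1 / sqrt (4 * pi * lam)) * (LINT s|lborel. T_integrand u lam s)"

definition T_exists :: "(real \<Rightarrow> complex) \<Rightarrow> real \<Rightarrow> bool" where
  "T_exists u lam \<longleftrightarrow> integrable lborel (T_integrand u lam)"

text \<open>When \<open>\<rho>\<close> vanishes at \<open>sqrt (\<beta> j / \<Lambda>)\<close>, the deformed entry is infinite and its coordinate is
  dropped. Division by zero makes \<open>deformed \<beta> \<rho> \<Lambda> j\<close> equal to 0 there, so that
  \<open>1 / deformed \<beta> \<rho> \<Lambda> j = 0\<close> as it should be; \<open>kept\<close> excludes such \<open>j\<close> everywhere else.\<close>

definition deformed :: "(nat \<Rightarrow> real) \<Rightarrow> (real \<Rightarrow> real) \<Rightarrow> real \<Rightarrow> nat \<Rightarrow> real" where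
  "deformed \<beta> \<rho> \<Lambda> j = \<beta> j / \<rho> (sqrt (\<beta> j / \<Lambda>))"

definition kept :: "(nat \<Rightarrow> real) \<Rightarrow> (real \<Rightarrow> real) \<Rightarrow> real \<Rightarrow> nat set" where
  "kept \<beta> \<rho> \<Lambda> = {j. \<rho> (sqrt (\<beta> j / \<Lambda>)) \<noteq> 0}"

definition regularizing ::
  "(nat \<Rightarrow> real) \<Rightarrow> (real \<Rightarrow> real) \<Rightarrow> (real \<Rightarrow> real) \<Rightarrow> real \<Rightarrow> bool" where
  "regularizing \<beta> \<rho> r \<kappa> \<longleftrightarrow>
     continuous_on {0..} \<rho> \<and> \<rho> ` {0..} \<subseteq> {0..1} \<and> \<rho> 0 = 1 \<and>
     (\<forall>\<^sub>F \<Lambda> in at_top. summable (\<lambda>j. 1 / deformed \<beta> \<rho> \<Lambda> j)) \<and>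
     (\<lambda>\<Lambda>. (\<Sum>j. 1 / deformed \<beta> \<rho> \<Lambda> j) - (r \<Lambda> + \<kappa>)) \<in> o[at_top](\<lambda>_. 1) \<and>
     filterlim r at_top at_top"

definition Phi_reg :: "(nat \<Rightarrow> real) \<Rightarrow> (real \<Rightarrow> real) \<Rightarrow> real \<Rightarrow> real \<Rightarrow> complex" where
  "Phi_reg \<beta> \<rho> \<Lambda> s = Phi (kept \<beta> \<rho> \<Lambda>) s (deformed \<beta> \<rho> \<Lambda>)"

definition Z_reg :: "real \<Rightarrow> (nat \<Rightarrow> real) \<Rightarrow> (real \<Rightarrow> real) \<Rightarrow> real \<Rightarrow> real" where
  "Z_reg lam \<beta> \<rho> \<Lambda> = Z (kept \<beta> \<rho> \<Lambda>) lam (deformed \<beta> \<rho> \<Lambda>)"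

definition renormalized ::
  "real \<Rightarrow> (nat \<Rightarrow> real) \<Rightarrow> (real \<Rightarrow> real) \<Rightarrow> (real \<Rightarrow> real) \<Rightarrow> real \<Rightarrow> real \<Rightarrow> nat \<Rightarrow> real" where
  "renormalized lam \<beta> \<rho> r \<theta> \<Lambda> j = deformed \<beta> \<rho> \<Lambda> j - lam * r \<Lambda> - lam * \<theta>"

text \<open>The product \<open>Z(\<lambda>, \<beta>\<^sub>r(\<Lambda>)) N(\<Lambda>)\<close>, where
  \<open>N(\<Lambda>) = exp (- \<lambda> (r(\<Lambda>) + \<theta>)\<^sup>2 / 4) \<Prod>\<^sub>j sqrt (\<beta>\<^sub>j(\<Lambda>) / \<beta>\<^sub>r\<^sub>,\<^sub>j(\<Lambda>))\<close>: the square roots of the entries of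
  \<open>\<beta>\<^sub>r(\<Lambda>)\<close>, which may be non-positive, are cancelled between the two factors.\<close>

definition ZN_n ::
  "nat \<Rightarrow> real \<Rightarrow> (nat \<Rightarrow> real) \<Rightarrow> (real \<Rightarrow> real) \<Rightarrow> (real \<Rightarrow> real) \<Rightarrow> real \<Rightarrow> real \<Rightarrow> real" where
  "ZN_n n lam \<beta> \<rho> r \<theta> \<Lambda> =
     exp (- lam * (r \<Lambda> + \<theta>)\<^sup>2 / 4) *
     Z_gen_n (kept \<beta> \<rho> \<Lambda>) n (deformed \<beta> \<rho> \<Lambda>) lam (renormalized lam \<beta> \<rho> r \<theta> \<Lambda>)"

definition ZN ::
  "real \<Rightarrow> (nat \<Rightarrow> real) \<Rightarrow> (real \<Rightarrow> real) \<Rightarrow> (real \<Rightarrow> real) \<Rightarrow> real \<Rightarrow> real \<Rightarrow> real" where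
  "ZN lam \<beta> \<rho> r \<theta> \<Lambda> = lim (\<lambda>n. ZN_n n lam \<beta> \<rho> r \<theta> \<Lambda>)"

definition ZN_exists ::
  "real \<Rightarrow> (nat \<Rightarrow> real) \<Rightarrow> (real \<Rightarrow> real) \<Rightarrow> (real \<Rightarrow> real) \<Rightarrow> real \<Rightarrow> real \<Rightarrow> bool" where
  "ZN_exists lam \<beta> \<rho> r \<theta> \<Lambda> \<longleftrightarrow>
     (\<forall>n. integrable (Pi\<^sub>M ({..<n} \<inter> kept \<beta> \<rho> \<Lambda>) (\<lambda>_. lborel))
            (Z_integrand (kept \<beta> \<rho> \<Lambda>) n lam (renormalized lam \<beta> \<rho> r \<theta> \<Lambda>))) \<and>
     convergent (\<lambda>n. ZN_n n lam \<beta> \<rho> r \<theta> \<Lambda>)"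

definition Phi_shift ::
  "(nat \<Rightarrow> real) \<Rightarrow> (real \<Rightarrow> real) \<Rightarrow> (real \<Rightarrow> real) \<Rightarrow> real \<Rightarrow> real \<Rightarrow> real \<Rightarrow> complex" where
  "Phi_shift \<beta> \<rho> r \<theta> \<Lambda> s =
     Phi_reg \<beta> \<rho> \<Lambda> s * exp (- \<i> * complex_of_real (s * (r \<Lambda> + \<theta>) / 2))"

definition Phi_ren ::
  "(nat \<Rightarrow> real) \<Rightarrow> (real \<Rightarrow> real) \<Rightarrow> (real \<Rightarrow> real) \<Rightarrow> real \<Rightarrow> real \<Rightarrow> complex" where
  "Phi_ren \<beta> \<rho> r \<theta> s = Lim at_top (\<lambda>\<Lambda>. Phi_shift \<beta> \<rho> r \<theta> \<Lambda> s)"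

definition Z_ren ::
  "real \<Rightarrow> (nat \<Rightarrow> real) \<Rightarrow> (real \<Rightarrow> real) \<Rightarrow> (real \<Rightarrow> real) \<Rightarrow> real \<Rightarrow> real" where
  "Z_ren lam \<beta> \<rho> r \<theta> = Lim at_top (\<lambda>\<Lambda>. ZN lam \<beta> \<rho> r \<theta> \<Lambda>)"

definition f_fun :: "(nat \<Rightarrow> real) \<Rightarrow> real \<Rightarrow> real" where
  "f_fun \<beta> s = (\<Prod>j. (1 + s\<^sup>2 / (\<beta> j)\<^sup>2) powr (- 1 / 4))"

definition f_exists :: "(nat \<Rightarrow> real) \<Rightarrow> real \<Rightarrow> bool" where
  "f_exists \<beta> s \<longleftrightarrow> convergent_prod (\<lambda>j. (1 + s\<^sup>2 / (\<beta> j)\<^sup>2) powr (- 1 / 4))"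

definition g_term :: "(nat \<Rightarrow> real) \<Rightarrow> real \<Rightarrow> real \<Rightarrow> nat \<Rightarrow> real" where
  "g_term \<beta> s t j = (t\<^sup>2 / \<beta> j ^ 3) / (1 + s\<^sup>2 * t\<^sup>2 / (\<beta> j)\<^sup>2)"

definition gr_fun :: "real \<Rightarrow> (nat \<Rightarrow> real) \<Rightarrow> real \<Rightarrow> real" where
  "gr_fun \<kappa> \<beta> s = - s * \<kappa> + s ^ 3 * (LINT t:{0..1}|lborel. (\<Sum>j. g_term \<beta> s t j))"

definition gr_exists :: "(nat \<Rightarrow> real) \<Rightarrow> real \<Rightarrow> bool" where
  "gr_exists \<beta> s \<longleftrightarrow>
     (\<forall>t\<in>{0..1}. summable (g_term \<beta> s t)) \<and>
     set_integrable lborel {0..1} (\<lambda>t. \<Sum>j. g_term \<beta> s t j)"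

end

theory Submission
  imports Defs "HOL-Probability.Probability" "HOL-Complex_Analysis.Complex_Analysis"
begin

text \<open>Each Gaussian factor of \<open>\<Phi>\<^sub>n\<close> equals \<open>(1 - i s / \<beta>\<^sub>j) powr (- 1 / 2)\<close>, so \<open>\<Phi>\<close> is the exponential of
  a series in the numbers \<open>s / \<beta>\<^sub>j\<close>; the linear part of its phase is the only divergent one, and
  subtracting it leaves a series dominated by \<open>\<Sum>\<^sub>j s\<^sup>2 / \<beta>\<^sub>j\<^sup>2\<close>, to which Tannery's theorem applies.
  Writing \<open>exp (- \<lambda> (q - c / 2)\<^sup>2)\<close> as the Fourier transform of a Gaussian (Hubbard-Stratonovich) and
  exchanging integrals identifies the finite-dimensional \<open>Z\<close> with \<open>T\<close> applied to \<open>\<Phi>\<^sub>n\<close>; as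
  \<open>|\<Phi>\<^sub>n| \<le> 1\<close>, dominated convergence passes both to the limit in \<open>n\<close> and to the limit in \<open>\<Lambda>\<close>.
  Finally \<open>Z\<close>, as a function of \<open>\<theta>\<close>, is the Fourier transform of a function with Gaussian decay, hence the
  restriction of an entire function. It does not vanish identically because the transformed function is
  continuous and nonzero at \<open>0\<close>, so its zeros are countable.\<close>

section \<open>Gaussian integrals\<close>

text \<open>Bounding the partial sums of norms by one integrable \<open>w\<close> yields both
  hypotheses of the termwise integration theorems: absolute summability at each point, and
  summability of the integrals of the norms.\<close>

lemma sums_integral_dominated:
  fixes f :: "nat \<Rightarrow> 'a \<Rightarrow> 'b::{banach, second_countable_topology}"
  assumes f[measurable]: "\<And>i. f i \<in> borel_measurable M"
    and w: "integrable M w"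
    and bound: "\<And>n x. x \<in> space M \<Longrightarrow> (\<Sum>i<n. norm (f i x)) \<le> w x"
  shows "integrable M (\<lambda>x. \<Sum>i. f i x)"
    and "(\<lambda>i. integral\<^sup>L M (f i)) sums (LINT x|M. (\<Sum>i. f i x))"
proof -
  have le: "norm (f i x) \<le> w x" if "x \<in> space M" for i x
  proof -
    have "norm (f i x) \<le> (\<Sum>j<Suc i. norm (f j x))"
      by (simp add: sum_nonneg)
    then show ?thesis using bound[OF that, of "Suc i"] by linarith
  qed
  have int: "integrable M (f i)" for i
    by (rule Bochner_Integration.integrable_bound[OF w])
      (auto intro!: order_trans[OF le abs_ge_self])
  have 1: "summable (\<lambda>i. norm (f i x))" if "x \<in> space M" for x
    by (rule summableI_nonneg_bounded[where x = "w x"]) (use bound[OF that] in auto)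
  have 2: "summable (\<lambda>i. LINT x|M. norm (f i x))"
  proof (rule summableI_nonneg_bounded)
    fix n
    have "(\<Sum>i<n. LINT x|M. norm (f i x)) = (LINT x|M. (\<Sum>i<n. norm (f i x)))"
      by (subst Bochner_Integration.integral_sum) (use int in auto)
    also have "\<dots> \<le> (LINT x|M. w x)"
      by (rule integral_mono) (use int w bound in auto)
    finally show "(\<Sum>i<n. LINT x|M. norm (f i x)) \<le> integral\<^sup>L M w" .
  qed simp
  show "integrable M (\<lambda>x. \<Sum>i. f i x)"
    by (rule integrable_suminf[OF int _ 2]) (use 1 in auto)
  show "(\<lambda>i. integral\<^sup>L M (f i)) sums (LINT x|M. (\<Sum>i. f i x))"
    by (rule sums_integral[OF int _ 2]) (use 1 in auto)
qed

lemma sum_power_fact_le_exp: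
  fixes x :: real
  assumes "0 \<le> x"
  shows "(\<Sum>i<n. x ^ i / fact i) \<le> exp x"
  using sum_le_suminf[OF summable_exp, of "{..<n}" x] assms
  by (simp add: exp_def divide_inverse scaleR_conv_of_real mult.commute)

text \<open>Expanding \<open>exp ((w - z0) * k s)\<close> in powers of \<open>w - z0\<close> and
  integrating termwise gives a power series around each \<open>z0\<close>. Openness of
  \<open>X\<close> provides room to move the real exponent both ways, which is what the domination
  costs.\<close>

lemma holomorphic_on_laplace:
  fixes h :: "'a \<Rightarrow> complex" and k :: "'a \<Rightarrow> real"
  assumes [measurable]: "h \<in> borel_measurable M" "k \<in> borel_measurable M"
    and X: "open X"
    and int: "\<And>x. x \<in> X \<Longrightarrow> integrable M (\<lambda>s. norm (h s) * exp (x * k s))"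
  shows "(\<lambda>z. LINT s|M. h s * exp (z * complex_of_real (k s))) holomorphic_on {z. Re z \<in> X}"
    (is "?F holomorphic_on _")
proof -
  have "?F field_differentiable at z0" if z0: "Re z0 \<in> X" for z0
  proof -
    obtain d where d: "d > 0" "ball (Re z0) d \<subseteq> X"
      using X z0 open_contains_ball by blast
    let ?a = "\<lambda>n. LINT s|M. h s * exp (z0 * of_real (k s)) * of_real (k s) ^ n / fact n"
    have "?F holomorphic_on ball z0 d"
    proof (rule power_series_holomorphic)
      fix w assume w: "w \<in> ball z0 d"
      define \<delta> where "\<delta> = norm (w - z0)"
      have \<delta>: "0 \<le> \<delta>" "\<delta> < d" using w by (auto simp: \<delta>_def dist_norm norm_minus_commute)
      define f where "f n s = h s * exp (z0 * of_real (k s)) * ((w - z0) * of_real (k s)) ^ n / fact n" for n s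
      \<comment> \<open>\<open>exp (\<delta> * \<bar>k s\<bar>)\<close> is at most the sum of the
        exponentials with either sign, so two real exponents at distance \<open>\<delta>\<close>
        from \<open>Re z0\<close> dominate all partial sums.\<close>
      let ?B = "\<lambda>s. norm (h s) * exp ((Re z0 + \<delta>) * k s) + norm (h s) * exp ((Re z0 - \<delta>) * k s)"
      have B: "integrable M ?B"
        by (intro Bochner_Integration.integrable_add int subsetD[OF d(2)]) (use \<delta> in \<open>auto simp: dist_real_def\<close>)
      have bound: "(\<Sum>i<n. norm (f i s)) \<le> ?B s" for n s
      proof -
        have "(\<Sum>i<n. norm (f i s)) = norm (h s) * exp (Re z0 * k s) * (\<Sum>i<n. (\<delta> * \<bar>k s\<bar>) ^ i / fact i)"
          by (simp add: f_def norm_mult norm_divide norm_power \<delta>_def sum_distrib_left power_mult_distrib)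
        also have "\<dots> \<le> norm (h s) * exp (Re z0 * k s) * exp (\<delta> * \<bar>k s\<bar>)"
          by (intro mult_left_mono sum_power_fact_le_exp) (use \<delta> in auto)
        also have "\<dots> \<le> norm (h s) * (exp ((Re z0 + \<delta>) * k s) + exp ((Re z0 - \<delta>) * k s))"
          by (cases "k s \<ge> 0") (auto simp: mult.assoc exp_add[symmetric] algebra_simps intro!: mult_left_mono)
        finally show ?thesis by (simp add: algebra_simps)
      qed
      have [measurable]: "f n \<in> borel_measurable M" for n
        unfolding f_def by measurable
      have "(\<lambda>n. integral\<^sup>L M (f n)) sums (LINT s|M. (\<Sum>n. f n s))"
        by (rule sums_integral_dominated(2)[OF _ B]) (use bound in auto)
      also have "(\<lambda>s. \<Sum>n. f n s) = (\<lambda>s. h s * exp (w * of_real (k s)))"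
      proof
        fix s
        have "(\<lambda>n. ((w - z0) * of_real (k s)) ^ n /\<^sub>R fact n) sums exp ((w - z0) * of_real (k s))"
          by (rule exp_converges)
        then have "(\<lambda>n. h s * exp (z0 * of_real (k s)) * (((w - z0) * of_real (k s)) ^ n /\<^sub>R fact n)) sums
            (h s * exp (z0 * of_real (k s)) * exp ((w - z0) * of_real (k s)))"
          by (rule sums_mult)
        also have "(\<lambda>n. h s * exp (z0 * of_real (k s)) * (((w - z0) * of_real (k s)) ^ n /\<^sub>R fact n)) = (\<lambda>n. f n s)"
          by (auto simp: f_def scaleR_conv_of_real field_simps)
        also have "h s * exp (z0 * of_real (k s)) * exp ((w - z0) * of_real (k s)) = h s * exp (w * of_real (k s))"
          by (simp add: mult.assoc exp_add[symmetric] algebra_simps)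
        finally show "(\<Sum>n. f n s) = h s * exp (w * of_real (k s))" by (rule sums_unique[symmetric])
      qed
      also have "(\<lambda>n. integral\<^sup>L M (f n)) = (\<lambda>n. ?a n * (w - z0) ^ n)"
      proof
        fix n
        have "f n = (\<lambda>s. (h s * exp (z0 * of_real (k s)) * of_real (k s) ^ n / fact n) * (w - z0) ^ n)"
          by (auto simp: f_def power_mult_distrib)
        then show "integral\<^sup>L M (f n) = ?a n * (w - z0) ^ n" by (simp only: integral_mult_left_zero)
      qed
      finally show "(\<lambda>n. ?a n * (w - z0) ^ n) sums ?F w" .
    qed
    then show ?thesis
      using d by (intro holomorphic_on_imp_differentiable_at[of _ "ball z0 d"]) auto
  qed
  then show ?thesis
    by (auto simp: holomorphic_on_def intro: field_differentiable_at_within)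
qed

section \<open>Gaussians with real and complex coefficient, and their Fourier transform\<close>

lemma gaussian_real:
  assumes "(c::real) > 0"
  shows "has_bochner_integral lborel (\<lambda>x::real. exp (- (c * x\<^sup>2))) (sqrt (pi / c))"
proof -
  have eq: "sqrt (pi / c) * normal_density 0 (sqrt (1 / (2 * c))) x = exp (- (c * x\<^sup>2))" for x
    using assms by (simp add: normal_density_def real_sqrt_divide real_sqrt_mult field_simps)
  have "has_bochner_integral lborel (\<lambda>x. sqrt (pi / c) * normal_density 0 (sqrt (1 / (2 * c))) x) (sqrt (pi / c) * 1)"
    by (intro has_bochner_integral_mult_right)
      (use assms in \<open>simp add: has_bochner_integral_iff\<close>)
  then show ?thesis by (simp only: eq mult_1_right)
qed

lemma integrable_gaussian_real [intro]: "(c::real) > 0 \<Longrightarrow> integrable lborel (\<lambda>x::real. exp (- (c * x\<^sup>2)))"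
  using gaussian_real by (auto simp: has_bochner_integral_iff)

lemma integrable_gaussian_complex:
  assumes "Re z > 0"
  shows "integrable lborel (\<lambda>a::real. exp (- (z * of_real (a\<^sup>2))))"
  by (rule Bochner_Integration.integrable_bound[OF integrable_gaussian_real[OF assms]]) auto

text \<open>Both sides are holomorphic on the right half-plane and agree on the positive real axis,
  so the identity theorem applies. The principal branch \<open>Ln\<close> selects the correct square
  root.\<close>

lemma integral_gaussian_complex:
  assumes "Re z > 0"
  shows "(LINT a|lborel. exp (- (z * of_real (a\<^sup>2)))) = of_real (sqrt pi) * exp (- (Ln z / 2))"
proof -
  let ?S = "{z. Re z > 0}"
  \<comment> \<open>Written as a Laplace transform with \<open>h = 1\<close> and \<open>k\<close>
    equal to minus the square, to fit \<open>holomorphic_on_laplace\<close>.\<close>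
  let ?F = "\<lambda>z. LINT a|lborel. 1 * exp (z * complex_of_real (- (a\<^sup>2)))"
  let ?G = "\<lambda>z. of_real (sqrt pi) * exp (- (Ln z / 2))"
  have "?F holomorphic_on {z. Re z \<in> {0<..}}"
    by (rule holomorphic_on_laplace) auto
  then have holF: "?F holomorphic_on ?S" by simp
  have holG: "?G holomorphic_on ?S"
    by (intro holomorphic_intros) (auto simp: complex_nonpos_Reals_iff)
  have "?F z - ?G z = 0"
  proof (rule analytic_continuation[where f = "\<lambda>z. ?F z - ?G z" and w = z and S = ?S and U = "complex_of_real ` {0<..}" and \<xi> = 1])
    show "(\<lambda>z. ?F z - ?G z) holomorphic_on ?S"
      using holF holG by (rule holomorphic_on_diff)
    show "open ?S" by (rule open_halfspace_Re_gt)
    show "connected ?S" by (intro convex_connected convex_halfspace_Re_gt)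
    show "1 islimpt complex_of_real ` {0<..}"
      unfolding islimpt_approachable
    proof (intro allI impI)
      fix e :: real assume "e > 0"
      have "complex_of_real (1 + e / 2) - 1 = of_real (e / 2)" by simp
      then have "dist (complex_of_real (1 + e / 2)) 1 = e / 2"
        unfolding dist_norm using \<open>e > 0\<close> by (simp only: norm_of_real)
      moreover have "complex_of_real (1 + e / 2) \<noteq> 1"
        using \<open>e > 0\<close> by (simp add: complex_eq_iff)
      ultimately show "\<exists>x'\<in>complex_of_real ` {0<..}. x' \<noteq> 1 \<and> dist x' 1 < e"
        using \<open>e > 0\<close> by (intro bexI[of _ "complex_of_real (1 + e / 2)"] conjI imageI)
          (simp_all only:, auto)
    qed
    fix w assume "w \<in> complex_of_real ` {0<..}"
    then obtain x where x: "w = of_real x" "x > 0" by auto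
    have "1 * exp (w * complex_of_real (- (a\<^sup>2))) = complex_of_real (exp (- (x * a\<^sup>2)))" for a
    proof -
      have "w * complex_of_real (- (a\<^sup>2)) = of_real (- (x * a\<^sup>2))" by (simp add: x)
      then show ?thesis by (simp only: exp_of_real mult_1_left)
    qed
    then have "?F w = complex_of_real (LINT a|lborel. exp (- (x * a\<^sup>2)))"
      by (simp only: integral_complex_of_real)
    also have "\<dots> = of_real (sqrt (pi / x))"
      using gaussian_real[OF x(2)] by (simp add: has_bochner_integral_iff)
    also have "sqrt (pi / x) = sqrt pi * exp (- (ln x / 2))"
      using x by (simp add: real_sqrt_divide exp_minus ln_sqrt[symmetric] inverse_eq_divide)
    also have "complex_of_real \<dots> = ?G w"
      using x by (simp add: Ln_of_real exp_of_real[symmetric])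
    finally show "?F w - ?G w = 0" by simp
  qed (use assms in auto)
  then show ?thesis by simp
qed

text \<open>This is the characteristic function of the standard normal law after the substitution
  \<open>s = k * x\<close>, where \<open>k = sqrt (2 * c)\<close> is the standard deviation of the
  Gaussian weight.\<close>

lemma integral_gaussian_fourier:
  fixes c u :: real
  assumes "c > 0"
  shows "(LINT s|lborel. complex_of_real (exp (- s\<^sup>2 / (4 * c))) * exp (\<i> * of_real (s * u))) =
    complex_of_real (sqrt (4 * pi * c) * exp (- c * u\<^sup>2))"
proof -
  define k where "k = sqrt (2 * c)"
  have k: "k > 0" "k\<^sup>2 = 2 * c" using assms by (auto simp: k_def)
  let ?f = "\<lambda>s. complex_of_real (exp (- s\<^sup>2 / (4 * c))) * exp (\<i> * of_real (s * u))"
  have "exp (- ((u * k)\<^sup>2) / 2) = (LINT x|std_normal_distribution. iexp (u * k * x))"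
    using fun_cong[OF char_std_normal_distribution, of "u * k"] by (simp add: char_def)
  also have "\<dots> = (LINT x|lborel. std_normal_density x *\<^sub>R iexp (u * k * x))"
    by (rule integral_density) (auto simp: normal_density_nonneg)
  also have "\<dots> = (LINT x|lborel. complex_of_real (1 / sqrt (2 * pi)) * ?f (0 + k * x))"
    using k assms by (intro Bochner_Integration.integral_cong)
      (auto simp: normal_density_def scaleR_conv_of_real power_mult_distrib algebra_simps)
  also have "\<dots> = complex_of_real (1 / sqrt (2 * pi)) * (LINT x|lborel. ?f (0 + k * x))"
    by (rule integral_mult_right_zero)
  finally have 1: "(LINT x|lborel. ?f (0 + k * x)) = complex_of_real (sqrt (2 * pi)) * exp (- ((u * k)\<^sup>2) / 2)"
    by simp
  have "(LINT s|lborel. ?f s) = \<bar>k\<bar> *\<^sub>R (LINT x|lborel. ?f (0 + k * x))"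
    by (rule lborel_integral_real_affine) (use k in auto)
  also have "\<dots> = complex_of_real (k * sqrt (2 * pi) * exp (- ((u * k)\<^sup>2) / 2))"
    unfolding 1 using k(1) by (simp add: scaleR_conv_of_real)
  also have "k * sqrt (2 * pi) = sqrt (4 * pi * c)"
    unfolding k_def by (simp add: real_sqrt_mult[symmetric] algebra_simps)
  also have "- ((u * k)\<^sup>2) / 2 = - c * u\<^sup>2" by (simp add: power_mult_distrib k)
  finally show ?thesis .
qed

section \<open>The product \<open>\<Phi>\<close>\<close>

text \<open>This is -1/2 times the principal logarithm of 1 - i y, the logarithm of one Gaussian
  factor at y = s / beta_j, split into real and imaginary part.\<close>

definition log_factor :: "real \<Rightarrow> complex" where
  "log_factor y = Complex (- (ln (1 + y\<^sup>2) / 4)) (arctan y / 2)"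

text \<open>The linear phase i y / 2 is removed. What remains is of order y^2, so that its series
  converges when only the squares of the inverse entries are summable.\<close>

definition log_factor_ren :: "real \<Rightarrow> complex" where
  "log_factor_ren y = Complex (- (ln (1 + y\<^sup>2) / 4)) ((arctan y - y) / 2)"

lemma one_plus_square_pos: "1 + (y::real)\<^sup>2 > 0"
  by (rule add_pos_nonneg) auto

lemma Re_log_factor_le: "Re (log_factor y) \<le> 0" and Re_log_factor_ren_le: "Re (log_factor_ren y) \<le> 0"
  by (auto simp: log_factor_def log_factor_ren_def)

lemma log_factor_ren_eq: "log_factor_ren y = log_factor y - \<i> * complex_of_real (y / 2)"
  by (simp add: log_factor_def log_factor_ren_def complex_eq_iff diff_divide_distrib)

lemma log_factor_0 [simp]: "log_factor 0 = 0" "log_factor_ren 0 = 0"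
  by (auto simp: log_factor_def log_factor_ren_def complex_eq_iff)

lemma isCont_log_factor: "isCont log_factor y"
  unfolding log_factor_def Complex_eq using one_plus_square_pos[of y] by (intro continuous_intros) auto

lemma isCont_log_factor_ren: "isCont log_factor_ren y"
  unfolding log_factor_ren_def Complex_eq using one_plus_square_pos[of y] by (intro continuous_intros) auto

lemma borel_measurable_log_factor [measurable]:
  "log_factor \<in> borel_measurable borel" "log_factor_ren \<in> borel_measurable borel"
  by (auto intro!: borel_measurable_continuous_onI continuous_at_imp_continuous_on
      isCont_log_factor isCont_log_factor_ren)

lemma abs_arctan_le: "\<bar>arctan y\<bar> \<le> \<bar>y\<bar>"
proof -
  have "arctan x \<le> x" if "x \<ge> 0" for x
    using that arctan_le_self by blast
  from this[of y] this[of "- y"] show ?thesis by (cases "y \<ge> 0") (simp_all add: arctan_minus)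
qed

text \<open>On the nonnegative axis \<open>x\<^sup>2 - (x - arctan x)\<close> has a nonnegative
  derivative and vanishes at 0; oddness of arctan covers the other half. A quadratic bound matches
  the summability available in \<open>seqs 2\<close>.\<close>

lemma abs_arctan_diff_le: "\<bar>arctan y - y\<bar> \<le> y\<^sup>2"
proof -
  have *: "x - arctan x \<le> x\<^sup>2 \<and> arctan x \<le> x" if "x \<ge> 0" for x :: real
  proof
    show "arctan x \<le> x" using that abs_arctan_le[of x] by auto
    have "(\<lambda>x. x\<^sup>2 - (x - arctan x)) 0 \<le> (\<lambda>x. x\<^sup>2 - (x - arctan x)) x"
    proof (rule DERIV_nonneg_imp_nondecreasing[OF that])
      fix t :: real assume t: "0 \<le> t" "t \<le> x"
      have "((\<lambda>x. x\<^sup>2 - (x - arctan x)) has_real_derivative 2 * t - (1 - inverse (1 + t\<^sup>2))) (at t)"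
        by (auto intro!: derivative_eq_intros)
      moreover have "2 * t - (1 - inverse (1 + t\<^sup>2)) \<ge> 0"
      proof -
        have "t\<^sup>2 \<le> 2 * t * (1 + t\<^sup>2)"
        proof (cases "t \<le> 1")
          case True
          then have "t\<^sup>2 \<le> 2 * t * 1" using t by (simp add: power2_eq_square mult_mono)
          also have "\<dots> \<le> 2 * t * (1 + t\<^sup>2)" using t by (intro mult_left_mono) auto
          finally show ?thesis .
        next
          case False
          then have "1 * t\<^sup>2 \<le> 2 * t * (1 + t\<^sup>2)" by (intro mult_mono) auto
          then show ?thesis by simp
        qed
        then have "t\<^sup>2 / (1 + t\<^sup>2) \<le> 2 * t"
          using one_plus_square_pos[of t] by (simp add: divide_le_eq)
        moreover have "1 - inverse (1 + t\<^sup>2) = t\<^sup>2 / (1 + t\<^sup>2)"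
          using one_plus_square_pos[of t] by (simp add: field_simps)
        ultimately show ?thesis by simp
      qed
      ultimately show "\<exists>y. ((\<lambda>x. x\<^sup>2 - (x - arctan x)) has_real_derivative y) (at t) \<and> 0 \<le> y"
        by blast
    qed
    then show "x - arctan x \<le> x\<^sup>2" by simp
  qed
  from *[of y] *[of "- y"] show ?thesis by (cases "y \<ge> 0") (auto simp: arctan_minus)
qed

lemma norm_log_factor_le: "norm (log_factor y) \<le> \<bar>y\<bar>"
proof -
  \<comment> \<open>Comparing with the perfect square turns the logarithm into
    \<open>2 * ln (1 + \<bar>y\<bar>)\<close>, which grows at most linearly in
    \<open>\<bar>y\<bar>\<close>.\<close>
  have "ln (1 + y\<^sup>2) \<le> ln ((1 + \<bar>y\<bar>)\<^sup>2)"
    using one_plus_square_pos[of y] by (intro ln_mono) (auto simp: power2_sum)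
  also have "\<dots> = 2 * ln (1 + \<bar>y\<bar>)" by (simp add: ln_realpow)
  also have "\<dots> \<le> 2 * \<bar>y\<bar>" by (simp add: ln_add_one_self_le_self)
  finally have "\<bar>Re (log_factor y)\<bar> \<le> \<bar>y\<bar> / 2" by (simp add: log_factor_def)
  moreover have "\<bar>Im (log_factor y)\<bar> \<le> \<bar>y\<bar> / 2" using abs_arctan_le[of y] by (simp add: log_factor_def)
  ultimately show ?thesis using cmod_le[of "log_factor y"] by linarith
qed

lemma norm_log_factor_ren_le: "norm (log_factor_ren y) \<le> y\<^sup>2"
proof -
  have "\<bar>Re (log_factor_ren y)\<bar> \<le> y\<^sup>2 / 2"
    using order_trans[OF ln_add_one_self_le_self[of "y\<^sup>2"], of "y\<^sup>2 * 2"]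
    by (simp add: log_factor_ren_def)
  moreover have "\<bar>Im (log_factor_ren y)\<bar> \<le> y\<^sup>2 / 2"
    using abs_arctan_diff_le[of y] by (simp add: log_factor_ren_def)
  ultimately show ?thesis using cmod_le[of "log_factor_ren y"] by linarith
qed

lemma Phi_integrand_eq:
  "Phi_integrand \<beta> s j a = exp (- (Complex (\<beta> j) (- s) * of_real (a\<^sup>2))) / complex_of_real (sqrt (pi / \<beta> j))"
  unfolding Phi_integrand_def by (simp add: Complex_eq algebra_simps)

text \<open>The exponent is a complex Gaussian with coefficient z = beta_j - i s. Its logarithm is
  ln beta_j plus the logarithm of 1 - i s / beta_j, and the normalization cancels the first
  term.\<close>

lemma Phi_factor:
  assumes "\<beta> j > 0"
  shows "integrable lborel (Phi_integrand \<beta> s j)"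
    and "(LINT a|lborel. Phi_integrand \<beta> s j a) = exp (log_factor (s / \<beta> j))"
proof -
  let ?z = "Complex (\<beta> j) (- s)"
  have z: "?z \<noteq> 0" using assms by (auto simp: complex_eq_iff)
  show "integrable lborel (Phi_integrand \<beta> s j)"
    unfolding Phi_integrand_eq[abs_def]
    by (intro integrable_divide_zero integrable_gaussian_complex) (use assms in auto)
  have nz: "cmod ?z = \<beta> j * sqrt (1 + (s / \<beta> j)\<^sup>2)"
  proof -
    have "(\<beta> j)\<^sup>2 + s\<^sup>2 = (\<beta> j)\<^sup>2 * (1 + (s / \<beta> j)\<^sup>2)"
      using assms by (simp add: field_simps)
    then show ?thesis using assms by (simp add: cmod_def real_sqrt_mult)
  qed
  have ln: "ln (cmod ?z) = ln (\<beta> j) + ln (1 + (s / \<beta> j)\<^sup>2) / 2"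
    using assms one_plus_square_pos[of "s / \<beta> j"] unfolding nz
    by (subst ln_mult) (auto simp: ln_sqrt)
  have Ln: "Ln ?z = Complex (ln (\<beta> j) + ln (1 + (s / \<beta> j)\<^sup>2) / 2) (- arctan (s / \<beta> j))"
    using assms z by (simp add: complex_eq_iff Im_Ln_eq Re_Ln ln arctan_minus)
  have sq: "sqrt pi / sqrt (pi / \<beta> j) = exp (ln (\<beta> j) / 2)"
    using assms by (simp add: real_sqrt_divide ln_sqrt[symmetric])
  have "(LINT a|lborel. Phi_integrand \<beta> s j a) = of_real (sqrt pi) * exp (- (Ln ?z / 2)) / of_real (sqrt (pi / \<beta> j))"
    unfolding Phi_integrand_eq using assms by (simp add: integral_gaussian_complex del: of_real_power)
  also have "\<dots> = complex_of_real (sqrt pi / sqrt (pi / \<beta> j)) * exp (- (Ln ?z / 2))" by simp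
  also have "\<dots> = exp (of_real (ln (\<beta> j) / 2) - Ln ?z / 2)"
    unfolding sq by (simp add: exp_diff exp_minus inverse_eq_divide flip: exp_of_real)
  also have "of_real (ln (\<beta> j) / 2) - Ln ?z / 2 = log_factor (s / \<beta> j)"
    unfolding Ln by (simp add: complex_eq_iff log_factor_def add_divide_distrib)
  finally show "(LINT a|lborel. Phi_integrand \<beta> s j a) = exp (log_factor (s / \<beta> j))" .
qed

text \<open>A dropped coordinate has weight \<open>0\<close>, and contributes the factor \<open>exp (log_factor 0) = 1\<close>.\<close>

definition weight :: "nat set \<Rightarrow> (nat \<Rightarrow> real) \<Rightarrow> nat \<Rightarrow> real" where
  "weight J \<nu> j = (if j \<in> J then 1 / \<nu> j else 0)"

lemma Phi_n_eq:
  assumes "\<forall>j\<in>J. \<nu> j > 0"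
  shows "Phi_n J n s \<nu> = exp (\<Sum>j<n. log_factor (s * weight J \<nu> j))"
proof -
  have "Phi_n J n s \<nu> = (\<Prod>j\<in>{..<n} \<inter> J. exp (log_factor (s * weight J \<nu> j)))"
    unfolding Phi_n_def using assms by (intro prod.cong) (auto simp: Phi_factor weight_def)
  also have "\<dots> = (\<Prod>j<n. exp (log_factor (s * weight J \<nu> j)))"
    by (intro prod.mono_neutral_left) (auto simp: weight_def)
  finally show ?thesis by (simp add: exp_sum)
qed

lemma summable_log_factor:
  assumes "summable (\<lambda>j. \<bar>x j\<bar>)"
  shows "summable (\<lambda>j. log_factor (s * x j))"
proof (rule summable_comparison_test)
  show "summable (\<lambda>j. \<bar>s\<bar> * \<bar>x j\<bar>)" by (intro summable_mult assms)
  show "\<exists>N. \<forall>n\<ge>N. norm (log_factor (s * x n)) \<le> \<bar>s\<bar> * \<bar>x n\<bar>"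
    using norm_log_factor_le[of "s * _"] by (simp add: abs_mult)
qed

lemma summable_log_factor_ren:
  assumes "summable (\<lambda>j. (x j)\<^sup>2)"
  shows "summable (\<lambda>j. norm (log_factor_ren (s * x j)))"
proof (rule summable_comparison_test)
  show "summable (\<lambda>j. s\<^sup>2 * (x j)\<^sup>2)" by (intro summable_mult assms)
  show "\<exists>N. \<forall>n\<ge>N. norm (norm (log_factor_ren (s * x n))) \<le> s\<^sup>2 * (x n)\<^sup>2"
    using norm_log_factor_ren_le[of "s * _"] by (simp add: power_mult_distrib)
qed

lemma Phi_limit:
  assumes "\<forall>j\<in>J. \<nu> j > 0" and "summable (\<lambda>j. \<bar>weight J \<nu> j\<bar>)"
  shows "(\<lambda>n. Phi_n J n s \<nu>) \<longlonglongrightarrow> exp (\<Sum>j. log_factor (s * weight J \<nu> j))"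
    and "Phi_exists J s \<nu>"
    and "Phi J s \<nu> = exp (\<Sum>j. log_factor (s * weight J \<nu> j))"
proof -
  show lim: "(\<lambda>n. Phi_n J n s \<nu>) \<longlonglongrightarrow> exp (\<Sum>j. log_factor (s * weight J \<nu> j))"
    unfolding Phi_n_eq[OF assms(1)]
    by (intro tendsto_intros summable_LIMSEQ summable_log_factor assms(2))
  show "Phi_exists J s \<nu>"
    unfolding Phi_exists_def using lim assms(1) by (auto simp: Phi_factor convergent_def)
  show "Phi J s \<nu> = exp (\<Sum>j. log_factor (s * weight J \<nu> j))"
    unfolding Phi_def using lim by (rule limI)
qed

lemma norm_exp_le_1: "Re z \<le> 0 \<Longrightarrow> norm (exp z) \<le> 1"
  by simp

lemma norm_Phi_n_le:
  assumes "\<forall>j\<in>J. \<nu> j > 0"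
  shows "norm (Phi_n J n s \<nu>) \<le> 1"
  unfolding Phi_n_eq[OF assms]
  by (intro norm_exp_le_1) (auto intro!: sum_nonpos Re_log_factor_le)

section \<open>Linearizing the quartic term\<close>

text \<open>Completing the square in the sum of the squares of the coordinates. Coefficients of
  unknown sign become the positive \<open>\<nu> j\<close>, times a factor at most 1 when
  \<open>lam\<close> is positive. Taking \<open>c = 0\<close> gives the plain integrand,
  \<open>c = r \<Lambda> + \<theta>\<close> the renormalized one with its exponential
  prefactor.\<close>

lemma Z_integrand_shift:
  "exp (- lam * c\<^sup>2 / 4) * Z_integrand J n lam (\<lambda>j. \<nu> j - lam * c) a =
    (\<Prod>j\<in>{..<n} \<inter> J. exp (- (\<nu> j * (a j)\<^sup>2))) * exp (- lam * ((\<Sum>j\<in>{..<n} \<inter> J. (a j)\<^sup>2) - c / 2)\<^sup>2)"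
proof -
  have "(\<Sum>j\<in>{..<n} \<inter> J. (\<nu> j - lam * c) * (a j)\<^sup>2) =
      (\<Sum>j\<in>{..<n} \<inter> J. \<nu> j * (a j)\<^sup>2) - lam * c * (\<Sum>j\<in>{..<n} \<inter> J. (a j)\<^sup>2)"
    by (simp add: left_diff_distrib sum_subtractf sum_distrib_left)
  then show ?thesis
    unfolding Z_integrand_def
    by (simp add: exp_sum[symmetric] sum_negf exp_add[symmetric] power2_diff power_divide algebra_simps)
qed

context
  fixes lam c :: real and J :: "nat set" and \<nu> :: "nat \<Rightarrow> real" and n :: nat
  assumes lam: "lam > 0" and \<nu>: "\<forall>j\<in>J. \<nu> j > 0"
begin

interpretation product_sigma_finite "\<lambda>_::nat. lborel :: real measure" ..

interpretation finite_product_sigma_finite "\<lambda>_::nat. lborel :: real measure" "{..<n} \<inter> J"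
  by standard simp

lemma integrable_Z_integrand:
  "integrable (Pi\<^sub>M ({..<n} \<inter> J) (\<lambda>_. lborel)) (Z_integrand J n lam (\<lambda>j. \<nu> j - lam * c))"
proof -
  let ?I = "{..<n} \<inter> J" and ?M = "Pi\<^sub>M ({..<n} \<inter> J) (\<lambda>_. lborel :: real measure)"
  have "integrable ?M (\<lambda>a. (\<Prod>j\<in>?I. exp (- (\<nu> j * (a j)\<^sup>2))))"
    by (rule product_integrable_prod) (use \<nu> in auto)
  then have "integrable ?M (\<lambda>a. (\<Prod>j\<in>?I. exp (- (\<nu> j * (a j)\<^sup>2))) *
      exp (- lam * ((\<Sum>j\<in>?I. (a j)\<^sup>2) - c / 2)\<^sup>2))"
    by (rule Bochner_Integration.integrable_bound)
      (use lam in \<open>auto simp: abs_mult prod_nonneg intro!: mult_left_le\<close>)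
  then have "integrable ?M (\<lambda>a. exp (- lam * c\<^sup>2 / 4) * Z_integrand J n lam (\<lambda>j. \<nu> j - lam * c) a)"
    unfolding Z_integrand_shift .
  then show ?thesis by simp
qed

text \<open>Hubbard-Stratonovich: the quartic factor is a Gaussian average over \<open>s\<close> of
  the phases \<open>exp (\<i> * s * (q a - c / 2))\<close>. Once the integrals are exchanged, the
  coordinates decouple and the integral over them factorizes into \<open>Phi_n\<close>.\<close>

lemma Z_gen_n_eq_T_op:
  "complex_of_real (exp (- lam * c\<^sup>2 / 4) * Z_gen_n J n \<nu> lam (\<lambda>j. \<nu> j - lam * c)) =
    T_op (\<lambda>s. Phi_n J n s \<nu> * exp (- \<i> * complex_of_real (s * c / 2))) lam"
proof -
  let ?I = "{..<n} \<inter> J" and ?M = "Pi\<^sub>M ({..<n} \<inter> J) (\<lambda>_. lborel :: real measure)"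
  define q where "q a = (\<Sum>j\<in>?I. (a j)\<^sup>2)" for a :: "nat \<Rightarrow> real"
  \<comment> \<open>The joint integrand: integrating it over \<open>s\<close> first gives the
    integrand of \<open>Z\<close> (\<open>inner\<close>), integrating over \<open>a\<close> first
    gives that of \<open>T_op\<close> (\<open>outer\<close>).\<close>
  define H where "H a s = complex_of_real (exp (- s\<^sup>2 / (4 * lam))) *
      exp (- \<i> * complex_of_real (s * c / 2)) * (\<Prod>j\<in>?I. Phi_integrand \<nu> s j (a j))" for a s
  let ?k = "\<Prod>j\<in>?I. 1 / sqrt (pi / \<nu> j)" and ?K = "1 / sqrt (4 * pi * lam)"
  have prod: "(\<Prod>j\<in>?I. Phi_integrand \<nu> s j (a j)) =
      complex_of_real (?k * (\<Prod>j\<in>?I. exp (- (\<nu> j * (a j)\<^sup>2)))) * exp (\<i> * of_real (s * q a))" for a s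
  proof -
    have "exp (\<i> * of_real (s * q a)) = (\<Prod>j\<in>?I. exp (\<i> * of_real (s * (a j)\<^sup>2)))"
      by (simp add: q_def exp_sum[symmetric] sum_distrib_left)
    then show ?thesis
      unfolding Phi_integrand_def
      by (simp add: prod.distrib[symmetric] exp_add exp_diff exp_minus divide_simps flip: exp_of_real)
        (simp add: mult.commute)
  qed
  have inner: "complex_of_real ?K * (LINT s|lborel. H a s) =
      complex_of_real (?k * exp (- lam * c\<^sup>2 / 4) * Z_integrand J n lam (\<lambda>j. \<nu> j - lam * c) a)" for a
  proof -
    let ?G = "complex_of_real (?k * (\<Prod>j\<in>?I. exp (- (\<nu> j * (a j)\<^sup>2))))"
    have "H a s = ?G * (complex_of_real (exp (- s\<^sup>2 / (4 * lam))) * exp (\<i> * of_real (s * (q a - c / 2))))" for s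
    proof -
      have eq: "exp (- \<i> * complex_of_real (s * c / 2)) * exp (\<i> * of_real (s * q a)) =
          exp (\<i> * of_real (s * (q a - c / 2)))"
        by (simp add: exp_add[symmetric] algebra_simps)
      show ?thesis unfolding H_def prod eq[symmetric] by (simp only: mult_ac)
    qed
    then have "(LINT s|lborel. H a s) = ?G * complex_of_real (sqrt (4 * pi * lam) * exp (- lam * (q a - c / 2)\<^sup>2))"
      using integral_gaussian_fourier[OF lam, of "q a - c / 2"] by simp
    moreover have "?K * (?k * (\<Prod>j\<in>?I. exp (- (\<nu> j * (a j)\<^sup>2))) * (sqrt (4 * pi * lam) * exp (- lam * (q a - c / 2)\<^sup>2))) =
        ?k * exp (- lam * c\<^sup>2 / 4) * Z_integrand J n lam (\<lambda>j. \<nu> j - lam * c) a"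
      unfolding mult.assoc[of ?k] Z_integrand_shift q_def using lam by simp
    ultimately show ?thesis by (simp only: of_real_mult[symmetric])
  qed
  interpret P: pair_sigma_finite ?M "lborel :: real measure" ..
  have meas: "case_prod H \<in> borel_measurable (?M \<Otimes>\<^sub>M lborel)"
    unfolding H_def Phi_integrand_def split_beta' by measurable
  \<comment> \<open>All phases have modulus 1, so the modulus is a function of \<open>s\<close>
    times a function of \<open>a\<close>, each integrable; this is what Fubini requires.\<close>
  have normH: "norm (H a s) = exp (- s\<^sup>2 / (4 * lam)) * \<bar>?k * (\<Prod>j\<in>?I. exp (- (\<nu> j * (a j)\<^sup>2)))\<bar>" for a s
    unfolding H_def prod by (simp add: norm_mult del: of_real_mult of_real_prod of_real_divide)
  have gauss: "integrable lborel (\<lambda>s. exp (- s\<^sup>2 / (4 * lam)))"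
    using integrable_gaussian_real[of "1 / (4 * lam)"] lam by simp
  have H_int: "integrable (?M \<Otimes>\<^sub>M lborel) (case_prod H)"
  proof (rule P.Fubini_integrable)
    show "case_prod H \<in> borel_measurable (?M \<Otimes>\<^sub>M lborel)" by (rule meas)
    have "integrable ?M (\<lambda>a. (\<Prod>j\<in>?I. exp (- (\<nu> j * (a j)\<^sup>2))))"
      by (rule product_integrable_prod) (use \<nu> in auto)
    then show "integrable ?M (\<lambda>x. LINT y|lborel. norm (case (x, y) of (a, s) \<Rightarrow> H a s))"
      by (simp add: normH)
    show "AE x in ?M. integrable lborel (\<lambda>y. case (x, y) of (a, s) \<Rightarrow> H a s)"
    proof (rule AE_I2)
      fix a assume [measurable]: "a \<in> space ?M"
      have "integrable lborel (\<lambda>s. exp (- s\<^sup>2 / (4 * lam)) * \<bar>?k * (\<Prod>j\<in>?I. exp (- (\<nu> j * (a j)\<^sup>2)))\<bar>)"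
        using gauss by simp
      moreover have "H a \<in> borel_measurable lborel"
        unfolding H_def Phi_integrand_def by measurable
      ultimately have "integrable lborel (H a)"
        by (rule Bochner_Integration.integrable_bound) (simp only: normH real_norm_def, simp)
      then show "integrable lborel (\<lambda>y. case (a, y) of (a, s) \<Rightarrow> H a s)" by simp
    qed
  qed
  have outer: "(LINT a|?M. H a s) =
      T_integrand (\<lambda>s. Phi_n J n s \<nu> * exp (- \<i> * complex_of_real (s * c / 2))) lam s" for s
  proof -
    have "(LINT a|?M. (\<Prod>j\<in>?I. Phi_integrand \<nu> s j (a j))) = Phi_n J n s \<nu>"
      unfolding Phi_n_def by (rule product_integral_prod) (use \<nu> Phi_factor in auto)
    then show ?thesis unfolding H_def T_integrand_def by simp
  qed
  have "complex_of_real (exp (- lam * c\<^sup>2 / 4) * Z_gen_n J n \<nu> lam (\<lambda>j. \<nu> j - lam * c)) =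
      (LINT a|?M. complex_of_real (?k * exp (- lam * c\<^sup>2 / 4) * Z_integrand J n lam (\<lambda>j. \<nu> j - lam * c) a))"
    unfolding integral_complex_of_real Z_gen_n_def by (simp add: mult_ac)
  also have "\<dots> = complex_of_real ?K * (LINT a|?M. LINT s|lborel. H a s)"
    unfolding inner[symmetric] by simp
  also have "(LINT a|?M. LINT s|lborel. H a s) = (LINT s|lborel. LINT a|?M. H a s)"
    using P.Fubini_integral[OF H_int] by simp
  finally show ?thesis unfolding outer T_op_def .
qed

end

section \<open>The limit of infinitely many variables\<close>

lemma integrable_T_kernel: "lam > 0 \<Longrightarrow> integrable lborel (\<lambda>s::real. exp (- s\<^sup>2 / (4 * lam)))"
  using integrable_gaussian_real[of "1 / (4 * lam)"] by simp

lemma T_exists_bounded: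
  assumes "lam > 0" and [measurable]: "u \<in> borel_measurable borel" and "\<And>s. norm (u s) \<le> 1"
  shows "T_exists u lam"
  unfolding T_exists_def T_integrand_def
  by (rule Bochner_Integration.integrable_bound[OF integrable_T_kernel[OF assms(1)]])
    (use assms in \<open>auto simp: norm_mult intro!: mult_left_le\<close>)

lemma T_op_LIMSEQ:
  assumes "lam > 0" and [measurable]: "\<And>n. u n \<in> borel_measurable borel" "v \<in> borel_measurable borel"
    and "\<And>n s. norm (u n s) \<le> 1" and "\<And>s. (\<lambda>n. u n s) \<longlonglongrightarrow> v s"
  shows "(\<lambda>n. T_op (u n) lam) \<longlonglongrightarrow> T_op v lam"
  unfolding T_op_def T_integrand_def
  by (intro tendsto_mult tendsto_const integral_dominated_convergence[OF _ _ integrable_T_kernel[OF assms(1)]])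
    (use assms in \<open>auto simp: norm_mult intro!: mult_left_le tendsto_mult\<close>)

text \<open>The Gaussian kernel dominates. The bound is asked only eventually, because the deformed
  sequence is controlled only for positive values of the cutoff.\<close>

lemma T_op_tendsto_at_top:
  assumes "lam > 0" and [measurable]: "\<And>t. u t \<in> borel_measurable borel" "v \<in> borel_measurable borel"
    and "\<forall>\<^sub>F t in at_top. \<forall>s. norm (u t s) \<le> 1" and "\<And>s. ((\<lambda>t. u t s) \<longlongrightarrow> v s) at_top"
  shows "((\<lambda>t::real. T_op (u t) lam) \<longlongrightarrow> T_op v lam) at_top"
  unfolding T_op_def T_integrand_def
proof (intro tendsto_mult tendsto_const integral_dominated_convergence_at_top)
  show "integrable lborel (\<lambda>s. exp (- s\<^sup>2 / (4 * lam)))" by (rule integrable_T_kernel[OF assms(1)])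
  show "\<forall>\<^sub>F t in at_top. AE s in lborel.
      norm (complex_of_real (exp (- s\<^sup>2 / (4 * lam))) * u t s) \<le> exp (- s\<^sup>2 / (4 * lam))"
    using assms(4) by eventually_elim (auto simp: norm_mult intro!: mult_left_le)
qed (use assms(5) in \<open>auto intro!: tendsto_mult\<close>)

text \<open>Every \<open>Phi_n\<close> has modulus at most 1, so dominated convergence carries the
  finite-dimensional identity to the limit.\<close>

lemma Z_gen_limit:
  fixes lam c :: real
  assumes lam: "lam > 0" and \<nu>: "\<forall>j\<in>J. \<nu> j > 0" and sm: "summable (\<lambda>j. \<bar>weight J \<nu> j\<bar>)"
  defines "u \<equiv> \<lambda>s. Phi J s \<nu> * exp (- \<i> * complex_of_real (s * c / 2))"
    and "a \<equiv> \<lambda>n. exp (- lam * c\<^sup>2 / 4) * Z_gen_n J n \<nu> lam (\<lambda>j. \<nu> j - lam * c)"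
  shows "T_exists u lam" and "convergent a" and "complex_of_real (lim a) = T_op u lam"
proof -
  let ?u = "\<lambda>n s. Phi_n J n s \<nu> * exp (- \<i> * complex_of_real (s * c / 2))"
  have [measurable]: "(\<lambda>s. Phi_n J n s \<nu>) \<in> borel_measurable borel" for n
    unfolding Phi_n_eq[OF \<nu>] by measurable
  have [measurable]: "(\<lambda>s. Phi J s \<nu>) \<in> borel_measurable borel"
    unfolding Phi_limit(3)[OF \<nu> sm] by measurable
  have lim: "(\<lambda>n. ?u n s) \<longlonglongrightarrow> u s" for s
    unfolding u_def Phi_limit(3)[OF \<nu> sm] by (intro tendsto_intros Phi_limit(1)[OF \<nu> sm])
  have le: "norm (?u n s) \<le> 1" for n s
    using norm_Phi_n_le[OF \<nu>] by (simp add: norm_mult)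
  have u_le: "norm (u s) \<le> 1" for s
    using tendsto_norm[OF lim] by (rule LIMSEQ_le_const2) (use le in auto)
  have [measurable]: "u \<in> borel_measurable borel" unfolding u_def by measurable
  show "T_exists u lam"
    by (rule T_exists_bounded[OF lam _ u_le]) measurable
  have T: "(\<lambda>n. T_op (?u n) lam) \<longlonglongrightarrow> T_op u lam"
    by (rule T_op_LIMSEQ[OF lam _ _ le lim]) measurable
  then have "(\<lambda>n. complex_of_real (a n)) \<longlonglongrightarrow> T_op u lam"
    unfolding a_def Z_gen_n_eq_T_op[OF lam \<nu>] .
  \<comment> \<open>The approximants are real, hence so is the limit, and the complex identity
    determines the real limit of \<open>a\<close>.\<close>
  from tendsto_Re[OF this] tendsto_Im[OF this]
  have "a \<longlonglongrightarrow> Re (T_op u lam)" "(\<lambda>n. 0) \<longlonglongrightarrow> Im (T_op u lam)" by auto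
  moreover from this(2) have "Im (T_op u lam) = 0" by (simp add: LIMSEQ_const_iff)
  ultimately show "convergent a" "complex_of_real (lim a) = T_op u lam"
    by (auto simp: convergent_def limI complex_eq_iff)
qed

section \<open>The renormalized limit\<close>

text \<open>One formula serves before and after the limit: the deformed sequence with
  \<open>c\<close> the remaining linear phase gives \<open>Phi_shift\<close>, the original sequence
  with \<open>c = \<kappa> - \<theta>\<close> gives its limit.\<close>

definition Phi_lim :: "(nat \<Rightarrow> real) \<Rightarrow> real \<Rightarrow> real \<Rightarrow> complex" where
  "Phi_lim \<beta> c s = exp ((\<Sum>j. log_factor_ren (s * (1 / \<beta> j))) + \<i> * complex_of_real (s * c / 2))"

lemma borel_measurable_Phi_lim [measurable]: "Phi_lim \<beta> c \<in> borel_measurable borel"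
  unfolding Phi_lim_def by measurable

lemma seqs_2D:
  assumes "\<beta> \<in> seqs 2"
  shows "\<beta> j > 0" "summable (\<lambda>j. (1 / \<beta> j)\<^sup>2)"
  using assms by (auto simp: seqs_def power_one_over)

lemma Re_suminf_le_0:
  fixes f :: "nat \<Rightarrow> complex"
  assumes "summable f" "\<And>j. Re (f j) \<le> 0"
  shows "Re (suminf f) \<le> 0"
proof -
  have "(\<lambda>j. Re (f j)) sums Re (suminf f)"
    using assms(1) by (intro sums_Re summable_sums)
  from sums_le[OF _ this sums_zero] show ?thesis using assms(2) by simp
qed

lemma norm_Phi_lim_le:
  assumes "summable (\<lambda>j. (1 / \<beta> j)\<^sup>2)"
  shows "norm (Phi_lim \<beta> c s) \<le> 1"
  unfolding Phi_lim_def
  using Re_suminf_le_0[OF summable_norm_cancel[OF summable_log_factor_ren[OF assms]] Re_log_factor_ren_le, of s]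
  by simp

section \<open>The modulus f and the phase g_r as series\<close>

lemma summable_inverse_cube:
  assumes "\<beta> \<in> seqs 2"
  shows "summable (\<lambda>j. 1 / \<beta> j ^ 3)"
proof (rule summable_comparison_test_ev)
  have "(\<lambda>j. (1 / \<beta> j)\<^sup>2) \<longlonglongrightarrow> 0"
    using seqs_2D(2)[OF assms] by (rule summable_LIMSEQ_zero)
  then have "\<forall>\<^sub>F j in sequentially. (1 / \<beta> j)\<^sup>2 < 1" by (rule order_tendstoD) simp
  then show "\<forall>\<^sub>F j in sequentially. norm (1 / \<beta> j ^ 3) \<le> (1 / \<beta> j)\<^sup>2"
  proof eventually_elim
    case (elim j)
    then have "1 / \<beta> j \<le> 1"
      using seqs_2D(1)[OF assms, of j] by (simp add: power_less_one_iff flip: abs_square_less_1)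
    then have "(1 / \<beta> j)\<^sup>2 * (1 / \<beta> j) \<le> (1 / \<beta> j)\<^sup>2 * 1" by (intro mult_left_mono) auto
    moreover have "norm (1 / \<beta> j ^ 3) = (1 / \<beta> j)\<^sup>2 * (1 / \<beta> j)"
      using seqs_2D(1)[OF assms, of j] by (simp add: power2_eq_square power3_eq_cube)
    ultimately show ?case by simp
  qed
qed (use seqs_2D(2)[OF assms] in auto)

text \<open>No factor vanishes, so the product is the exponential of the series of its logarithms.
  These are the real parts of \<open>log_factor_ren\<close>, since the subtracted linear term is
  purely imaginary.\<close>

lemma f_fun_eq:
  assumes "\<beta> \<in> seqs 2"
  shows "f_exists \<beta> s" and "f_fun \<beta> s = exp (\<Sum>j. Re (log_factor_ren (s * (1 / \<beta> j))))"
proof -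
  have sm: "summable (\<lambda>j. Re (log_factor_ren (s * (1 / \<beta> j))))"
    by (intro summable_Re summable_norm_cancel[OF summable_log_factor_ren] seqs_2D(2) assms)
  have eq: "(\<lambda>j. (1 + s\<^sup>2 / (\<beta> j)\<^sup>2) powr (- 1 / 4)) = (\<lambda>j. exp (Re (log_factor_ren (s * (1 / \<beta> j)))))"
  proof
    fix j
    have "1 + s\<^sup>2 / (\<beta> j)\<^sup>2 \<noteq> 0" using one_plus_square_pos[of "s / \<beta> j"] by (simp add: power_divide)
    then show "(1 + s\<^sup>2 / (\<beta> j)\<^sup>2) powr (- 1 / 4) = exp (Re (log_factor_ren (s * (1 / \<beta> j))))"
      by (simp add: powr_def log_factor_ren_def power_divide)
  qed
  have "raw_has_prod (\<lambda>j. exp (Re (log_factor_ren (s * (1 / \<beta> j))))) 0 (exp (\<Sum>j. Re (log_factor_ren (s * (1 / \<beta> j)))))"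
    by (intro sums_imp_has_prod_exp summable_sums sm)
  then have prod: "(\<lambda>j. exp (Re (log_factor_ren (s * (1 / \<beta> j))))) has_prod (exp (\<Sum>j. Re (log_factor_ren (s * (1 / \<beta> j)))))"
    by (simp add: has_prod_def)
  show "f_exists \<beta> s" unfolding f_exists_def eq using prod by (auto simp: has_prod_iff)
  show "f_fun \<beta> s = exp (\<Sum>j. Re (log_factor_ren (s * (1 / \<beta> j))))"
    unfolding f_fun_def eq using prod by (rule has_prod_unique[symmetric])
qed

lemma g_term_nonneg: "\<beta> j > 0 \<Longrightarrow> 0 \<le> g_term \<beta> s t j"
  unfolding g_term_def by (intro divide_nonneg_nonneg add_nonneg_nonneg) auto

lemma g_term_le:
  assumes "\<beta> j > 0" "t \<in> {0..1}"
  shows "g_term \<beta> s t j \<le> 1 / \<beta> j ^ 3"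
proof -
  have "g_term \<beta> s t j \<le> (1 / \<beta> j ^ 3) / 1"
    unfolding g_term_def using assms
    by (intro frac_le divide_right_mono) (auto simp: power_le_one)
  then show ?thesis by simp
qed

text \<open>In the variable t, an antiderivative of \<open>s ^ 3 * g_term \<beta> s t j\<close> is
  \<open>s * t / \<beta> j - arctan (s * t / \<beta> j)\<close>.\<close>

lemma integral_g_term:
  assumes "\<beta> j > 0"
  shows "s ^ 3 * (LINT t|lborel. indicator {0..1} t * g_term \<beta> s t j) =
    s * (1 / \<beta> j) - arctan (s * (1 / \<beta> j))"
proof -
  let ?b = "\<beta> j"
  have pos: "1 + (s * t / ?b)\<^sup>2 > 0" for t by (rule one_plus_square_pos)
  have "(LINT t|lborel. (s ^ 3 * g_term \<beta> s t j) * indicator {0..1} t) =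
      (s * 1 / ?b - arctan (s * 1 / ?b)) - (s * 0 / ?b - arctan (s * 0 / ?b))"
  proof (rule integral_FTC_Icc_real)
    fix t :: real
    have "((\<lambda>t. s * t / ?b - arctan (s * t / ?b)) has_real_derivative
        s / ?b - s / ?b * inverse (1 + (s * t / ?b)\<^sup>2)) (at t)"
      using assms by (auto intro!: derivative_eq_intros)
    also have "s / ?b - s / ?b * inverse (1 + (s * t / ?b)\<^sup>2) = s ^ 3 * g_term \<beta> s t j"
    proof -
      have "1 + (s * t / ?b)\<^sup>2 = 1 + s\<^sup>2 * t\<^sup>2 / ?b\<^sup>2" by (simp add: power_mult_distrib power_divide)
      moreover define D where "D = 1 + s\<^sup>2 * t\<^sup>2 / ?b\<^sup>2"
      ultimately have D: "1 + (s * t / ?b)\<^sup>2 = D" "D > 0" using pos[of t] by auto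
      have "s / ?b - s / ?b * inverse D = s / ?b * ((D - 1) / D)"
        using D(2) by (simp add: diff_divide_distrib right_diff_distrib inverse_eq_divide)
      also have "D - 1 = s\<^sup>2 * t\<^sup>2 / ?b\<^sup>2" by (simp add: D_def)
      finally show ?thesis
        unfolding D(1) g_term_def D_def[symmetric] using assms D(2)
        by (simp add: power2_eq_square power3_eq_cube)
    qed
    finally show "((\<lambda>t. s * t / ?b - arctan (s * t / ?b)) has_real_derivative s ^ 3 * g_term \<beta> s t j) (at t)" .
    show "isCont (\<lambda>t. s ^ 3 * g_term \<beta> s t j) t"
      unfolding g_term_def using assms pos[of t]
      by (intro continuous_intros) (auto simp: power_mult_distrib power_divide)
  qed simp
  also have "(\<lambda>t. (s ^ 3 * g_term \<beta> s t j) * indicator {0..1} t) = (\<lambda>t. s ^ 3 * (indicator {0..1} t * g_term \<beta> s t j))"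
    by (simp add: mult_ac)
  finally show ?thesis by simp
qed

text \<open>On the unit interval the terms are dominated by the summable inverse cubes, so sum and
  integral can be exchanged. Each integral is -2 times the imaginary part of the corresponding
  \<open>log_factor_ren\<close>.\<close>

lemma gr_fun_eq:
  assumes "\<beta> \<in> seqs 2"
  shows "gr_exists \<beta> s" and "gr_fun \<kappa> \<beta> s = - s * \<kappa> - 2 * (\<Sum>j. Im (log_factor_ren (s * (1 / \<beta> j))))"
proof -
  note pos = seqs_2D(1)[OF assms] and cube = summable_inverse_cube[OF assms]
  let ?f = "\<lambda>j (t::real). indicator {0..1} t * g_term \<beta> s t j"
  let ?w = "\<lambda>t::real. indicator {0..1} t * (\<Sum>j. 1 / \<beta> j ^ 3)"
  have g_sm: "summable (g_term \<beta> s t)" if "t \<in> {0..1}" for t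
    by (rule summable_comparison_test'[OF cube])
      (use g_term_nonneg[OF pos] g_term_le[OF pos that] in auto)
  have w: "integrable lborel ?w"
    by (intro integrable_mult_left integrable_real_indicator) auto
  have [measurable]: "?f j \<in> borel_measurable borel" for j
    unfolding g_term_def by measurable
  have bound: "(\<Sum>j<n. norm (?f j t)) \<le> ?w t" for n t
  proof (cases "t \<in> {0..1}")
    case True
    then have "(\<Sum>j<n. norm (?f j t)) \<le> (\<Sum>j<n. 1 / \<beta> j ^ 3)"
      using g_term_nonneg[OF pos] g_term_le[OF pos True] by (intro sum_mono) auto
    also have "\<dots> \<le> (\<Sum>j. 1 / \<beta> j ^ 3)"
      by (rule sum_le_suminf[OF cube]) (use pos in \<open>auto simp: less_imp_le\<close>)
    finally show ?thesis using True by simp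
  qed simp
  have suminf_eq: "(\<Sum>j. ?f j t) = indicator {0..1} t * (\<Sum>j. g_term \<beta> s t j)" for t
    by (cases "t \<in> {0..1}") auto
  have int: "integrable lborel (\<lambda>t. indicator {0..1} t * (\<Sum>j. g_term \<beta> s t j))"
    unfolding suminf_eq[symmetric] by (rule sums_integral_dominated(1)[OF _ w bound]) measurable
  then show "gr_exists \<beta> s"
    unfolding gr_exists_def set_integrable_def using g_sm by simp
  have "(\<lambda>j. integral\<^sup>L lborel (?f j)) sums (LINT t|lborel. indicator {0..1} t * (\<Sum>j. g_term \<beta> s t j))"
    unfolding suminf_eq[symmetric] by (rule sums_integral_dominated(2)[OF _ w bound]) measurable
  then have "(\<lambda>j. s ^ 3 * integral\<^sup>L lborel (?f j)) sums
      (s ^ 3 * (LINT t|lborel. indicator {0..1} t * (\<Sum>j. g_term \<beta> s t j)))"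
    by (rule sums_mult)
  also have "(\<lambda>j. s ^ 3 * integral\<^sup>L lborel (?f j)) = (\<lambda>j. - 2 * Im (log_factor_ren (s * (1 / \<beta> j))))"
    unfolding integral_g_term[OF pos] by (simp add: log_factor_ren_def diff_divide_distrib)
  finally have "s ^ 3 * (LINT t|lborel. indicator {0..1} t * (\<Sum>j. g_term \<beta> s t j)) =
      (\<Sum>j. - 2 * Im (log_factor_ren (s * (1 / \<beta> j))))"
    by (rule sums_unique)
  also have "\<dots> = - 2 * (\<Sum>j. Im (log_factor_ren (s * (1 / \<beta> j))))"
    by (intro suminf_mult summable_Im summable_norm_cancel[OF summable_log_factor_ren] seqs_2D(2) assms)
  finally show "gr_fun \<kappa> \<beta> s = - s * \<kappa> - 2 * (\<Sum>j. Im (log_factor_ren (s * (1 / \<beta> j))))"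
    unfolding gr_fun_def set_lebesgue_integral_def by simp
qed

lemma Phi_lim_eq:
  assumes "\<beta> \<in> seqs 2"
  shows "Phi_lim \<beta> (\<kappa> - \<theta>) s =
    complex_of_real (f_fun \<beta> s) * exp (- (\<i> / 2) * complex_of_real (s * \<theta> + gr_fun \<kappa> \<beta> s))"
proof -
  have sm: "summable (\<lambda>j. log_factor_ren (s * (1 / \<beta> j)))"
    by (intro summable_norm_cancel[OF summable_log_factor_ren] seqs_2D(2) assms)
  have "(\<Sum>j. log_factor_ren (s * (1 / \<beta> j))) =
      Complex (\<Sum>j. Re (log_factor_ren (s * (1 / \<beta> j)))) (\<Sum>j. Im (log_factor_ren (s * (1 / \<beta> j))))"
    using sums_unique[OF sums_Re[OF summable_sums[OF sm]]] sums_unique[OF sums_Im[OF summable_sums[OF sm]]]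
    by (simp add: complex_eq_iff)
  then show ?thesis
    unfolding Phi_lim_def f_fun_eq(2)[OF assms] gr_fun_eq(2)[OF assms]
    by (simp add: exp_of_real[symmetric] exp_add[symmetric] Complex_eq algebra_simps diff_divide_distrib)
qed

section \<open>Zeros of Fourier transforms\<close>

text \<open>The value at the origin is recovered by testing the vanishing Fourier transform against
  ever wider Gaussians.\<close>

lemma fourier_zero_imp_zero_at_0:
  fixes h :: "real \<Rightarrow> complex"
  assumes int: "integrable lborel h" and bdd: "\<And>s. norm (h s) \<le> B" and cont: "isCont h 0"
    and zero: "\<And>x::real. (LINT s|lborel. h s * exp (\<i> * of_real (x * s))) = 0"
  shows "h 0 = 0"
proof -
  have [measurable]: "h \<in> borel_measurable borel" using borel_measurable_integrable[OF int] by simp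
  \<comment> \<open>Multiply the vanishing transform by a Gaussian in \<open>x\<close>, integrate
    and exchange the integrals: the inner integral over \<open>x\<close> is a Gaussian in
    \<open>s\<close>.\<close>
  have gauss: "(LINT s|lborel. h s * complex_of_real (exp (- c * s\<^sup>2))) = 0" if c: "c > 0" for c
  proof -
    let ?G = "\<lambda>x. complex_of_real (exp (- x\<^sup>2 / (4 * c)))"
    have 1: "integrable (lborel \<Otimes>\<^sub>M lborel) (\<lambda>(s, x). ?G x * (h s * exp (\<i> * of_real (x * s))))"
    proof (rule lborel_pair.Fubini_integrable)
      show "integrable lborel (\<lambda>s. LINT x|lborel. norm (case (s, x) of (s, x) \<Rightarrow> ?G x * (h s * exp (\<i> * of_real (x * s)))))"
        using integrable_norm[OF int] by (simp add: norm_mult)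
      show "AE s in lborel. integrable lborel (\<lambda>x. case (s, x) of (s, x) \<Rightarrow> ?G x * (h s * exp (\<i> * of_real (x * s))))"
      proof (rule AE_I2)
        fix s
        have "integrable lborel (\<lambda>x. exp (- x\<^sup>2 / (4 * c)) * norm (h s))"
          using integrable_T_kernel[OF c] by simp
        then show "integrable lborel (\<lambda>x. case (s, x) of (s, x) \<Rightarrow> ?G x * (h s * exp (\<i> * of_real (x * s))))"
          by (rule Bochner_Integration.integrable_bound) (auto simp: norm_mult)
      qed
    qed measurable
    have "(LINT s|lborel. LINT x|lborel. ?G x * (h s * exp (\<i> * of_real (x * s)))) =
        (LINT x|lborel. LINT s|lborel. ?G x * (h s * exp (\<i> * of_real (x * s))))"
      using lborel_pair.Fubini_integral[OF 1] by simp
    also have "\<dots> = 0" using zero by simp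
    also have "(\<lambda>s. LINT x|lborel. ?G x * (h s * exp (\<i> * of_real (x * s)))) =
        (\<lambda>s. of_real (sqrt (4 * pi * c)) * (h s * complex_of_real (exp (- c * s\<^sup>2))))"
    proof
      fix s
      have "(LINT x|lborel. ?G x * (h s * exp (\<i> * of_real (x * s)))) =
          (LINT x|lborel. h s * (?G x * exp (\<i> * of_real (x * s))))"
        by (simp only: mult_ac)
      also have "\<dots> = h s * complex_of_real (sqrt (4 * pi * c) * exp (- c * s\<^sup>2))"
        unfolding integral_mult_right_zero integral_gaussian_fourier[OF c] ..
      finally show "(LINT x|lborel. ?G x * (h s * exp (\<i> * of_real (x * s)))) =
          of_real (sqrt (4 * pi * c)) * (h s * complex_of_real (exp (- c * s\<^sup>2)))"
        by (simp only: of_real_mult mult_ac)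
    qed
    finally show ?thesis using c by simp
  qed
  \<comment> \<open>With \<open>c\<close> the square of \<open>Suc n\<close>, the substitution of
    \<open>s / Suc n\<close> for \<open>s\<close> fixes the Gaussian and contracts the argument of
    \<open>h\<close> towards 0. The successor keeps the divisor nonzero.\<close>
  have scaled: "(LINT s|lborel. h (s / real (Suc n)) * complex_of_real (exp (- s\<^sup>2))) = 0" for n
  proof -
    let ?m = "real (Suc n)"
    let ?F = "\<lambda>s. h s * complex_of_real (exp (- ?m\<^sup>2 * s\<^sup>2))"
    have "0 = (LINT s|lborel. ?F s)" by (rule gauss[symmetric]) simp
    also have "\<dots> = \<bar>1 / ?m\<bar> *\<^sub>R (LINT s|lborel. ?F (0 + 1 / ?m * s))"
      by (rule lborel_integral_real_affine) simp
    also have "(\<lambda>s. ?F (0 + 1 / ?m * s)) = (\<lambda>s. h (s / ?m) * complex_of_real (exp (- s\<^sup>2)))"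
      by (simp add: power_divide del: of_nat_Suc)
    finally show ?thesis by simp
  qed
  have "(\<lambda>n. LINT s|lborel. h (s / real (Suc n)) * complex_of_real (exp (- s\<^sup>2))) \<longlonglongrightarrow>
      (LINT s|lborel. h 0 * complex_of_real (exp (- s\<^sup>2)))"
  proof (rule integral_dominated_convergence)
    show "integrable lborel (\<lambda>s::real. B * exp (- s\<^sup>2))"
      using integrable_gaussian_real[of 1] by simp
    show "AE s in lborel. (\<lambda>n. h (s / real (Suc n)) * complex_of_real (exp (- s\<^sup>2))) \<longlonglongrightarrow>
        h 0 * complex_of_real (exp (- s\<^sup>2))"
    proof (intro AE_I2 tendsto_mult tendsto_const isCont_tendsto_compose[OF cont])
      fix s :: real
      show "(\<lambda>n. s / real (Suc n)) \<longlonglongrightarrow> 0"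
        using tendsto_mult_right_zero[OF LIMSEQ_inverse_real_of_nat, of s] by (simp add: divide_inverse)
    qed
    show "AE s in lborel. norm (h (s / real (Suc n)) * complex_of_real (exp (- s\<^sup>2))) \<le> B * exp (- s\<^sup>2)" for n
      using bdd by (auto simp: norm_mult)
  qed measurable
  then have "(LINT s|lborel. h 0 * complex_of_real (exp (- s\<^sup>2))) = 0"
    unfolding scaled by (simp add: LIMSEQ_const_iff)
  moreover have "(LINT s|lborel. exp (- s\<^sup>2)) = sqrt pi"
    using gaussian_real[of 1] by (simp add: has_bochner_integral_iff)
  ultimately show ?thesis by (simp del: of_real_exp)
qed

text \<open>Gaussian decay makes the two-sided Laplace transform of \<open>h\<close> entire, and the
  Fourier transform is its restriction to the imaginary axis. It is not identically zero there
  because \<open>h 0\<close> is nonzero, so its zeros are countable.\<close>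

lemma countable_fourier_zeros:
  fixes h :: "real \<Rightarrow> complex"
  assumes meas[measurable]: "h \<in> borel_measurable borel" and bdd: "\<And>s. norm (h s) \<le> exp (- (c * s\<^sup>2))" and c: "c > 0"
    and cont: "isCont h 0" and h0: "h 0 \<noteq> 0"
  shows "countable {x::real. (LINT s|lborel. h s * exp (\<i> * of_real (x * s))) = 0}"
proof -
  let ?F = "\<lambda>z. LINT s|lborel. h s * exp (z * complex_of_real s)"
  have h_le_1: "norm (h s) \<le> 1" for s
    by (rule order_trans[OF bdd]) (use c in simp)
  have int: "integrable lborel h"
    by (rule Bochner_Integration.integrable_bound[OF integrable_gaussian_real[OF c]]) (use bdd in auto)
  have "?F holomorphic_on {z. Re z \<in> UNIV}"
  proof (rule holomorphic_on_laplace)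
    fix x :: real
    \<comment> \<open>Completing the square exhibits
      \<open>exp (- (c * s\<^sup>2)) * exp (x * s)\<close> as a multiple of a translated Gaussian,
      integrable for every real \<open>x\<close>.\<close>
    have eq: "exp (x\<^sup>2 / (4 * c)) * exp (- (c * (- (x / (2 * c)) + 1 * s)\<^sup>2)) = exp (- (c * s\<^sup>2)) * exp (x * s)" for s
    proof -
      have "x\<^sup>2 / (4 * c) + - (c * (- (x / (2 * c)) + 1 * s)\<^sup>2) = - (c * s\<^sup>2) + x * s"
        using c by (simp add: power2_eq_square field_simps)
      then show ?thesis by (simp only: exp_add[symmetric])
    qed
    have "integrable lborel (\<lambda>s. exp (- (c * (- (x / (2 * c)) + 1 * s)\<^sup>2)))"
      by (rule lborel_integrable_real_affine[OF integrable_gaussian_real[OF c]]) simp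
    then have "integrable lborel (\<lambda>s. exp (x\<^sup>2 / (4 * c)) * exp (- (c * (- (x / (2 * c)) + 1 * s)\<^sup>2)))"
      by (rule integrable_mult_right)
    then have "integrable lborel (\<lambda>s. exp (- (c * s\<^sup>2)) * exp (x * s))"
      unfolding eq .
    then show "integrable lborel (\<lambda>s. norm (h s) * exp (x * s))"
      by (rule Bochner_Integration.integrable_bound) (use bdd in \<open>auto simp: abs_mult intro!: mult_right_mono\<close>)
  qed auto
  then have hol: "?F holomorphic_on UNIV" by simp
  have nz: "\<exists>x::real. ?F (\<i> * of_real x) \<noteq> 0"
  proof (rule ccontr)
    assume "\<nexists>x::real. ?F (\<i> * of_real x) \<noteq> 0"
    then have "(LINT s|lborel. h s * exp (\<i> * of_real (x * s))) = 0" for x :: real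
      by (simp add: mult.assoc)
    then have "h 0 = 0" by (rule fourier_zero_imp_zero_at_0[OF int h_le_1 cont])
    with h0 show False by simp
  qed
  have "countable {z. ?F z = 0}"
  proof (cases "?F constant_on UNIV")
    \<comment> \<open>A constant transform takes a nonzero value by \<open>nz\<close>, so its zero
      set is empty; the theorem on countable zeros covers only nonconstant functions.\<close>
    case True
    then obtain y where y: "?F z = y" for z unfolding constant_on_def by blast
    then have "y \<noteq> 0" using nz by metis
    then show ?thesis unfolding y by simp
  next
    case False
    have "countable {z\<in>UNIV. ?F z = 0}"
      by (rule holomorphic_countable_zeros[OF hol open_UNIV connected_UNIV fsigma_UNIV False])
    then show ?thesis by simp
  qed
  moreover have "inj (\<lambda>x::real. \<i> * complex_of_real x)" by (auto intro: injI)
  ultimately have "countable {x::real. \<i> * complex_of_real x \<in> {z. ?F z = 0}}"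
    by (rule countable_image_inj)
  then show ?thesis by (simp only: mem_Collect_eq of_real_mult mult.assoc)
qed

text \<open>The series in the exponent is at most s^2 times the sum of the squared inverse entries,
  so it tends to 0 with s.\<close>

lemma isCont_Phi_lim_0:
  assumes "\<beta> \<in> seqs 2"
  shows "isCont (Phi_lim \<beta> c) 0"
proof -
  let ?S = "\<lambda>s. \<Sum>j. log_factor_ren (s * (1 / \<beta> j))" and ?C = "\<Sum>j. (1 / \<beta> j)\<^sup>2"
  have le: "norm (?S s) \<le> s\<^sup>2 * ?C" for s
  proof -
    note sm = summable_log_factor_ren[OF seqs_2D(2)[OF assms], of s]
    have "norm (?S s) \<le> (\<Sum>j. norm (log_factor_ren (s * (1 / \<beta> j))))"
      by (rule summable_norm[OF sm])
    also have "\<dots> \<le> (\<Sum>j. s\<^sup>2 * (1 / \<beta> j)\<^sup>2)"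
    proof (rule suminf_le[OF _ sm summable_mult[OF seqs_2D(2)[OF assms]]])
      show "norm (log_factor_ren (s * (1 / \<beta> j))) \<le> s\<^sup>2 * (1 / \<beta> j)\<^sup>2" for j
        using norm_log_factor_ren_le[of "s * (1 / \<beta> j)"] unfolding power_mult_distrib .
    qed
    also have "\<dots> = s\<^sup>2 * ?C" by (rule suminf_mult[OF seqs_2D(2)[OF assms]])
    finally show ?thesis .
  qed
  have "(?S \<longlongrightarrow> 0) (at 0)"
  proof (rule Lim_null_comparison)
    show "\<forall>\<^sub>F s in at 0. norm (?S s) \<le> s\<^sup>2 * ?C" using le by simp
    show "((\<lambda>s. s\<^sup>2 * ?C) \<longlongrightarrow> 0) (at 0)" by (auto intro!: tendsto_eq_intros)
  qed
  then have "isCont ?S 0" by (simp add: isCont_def)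
  then show ?thesis
    unfolding Phi_lim_def[abs_def] by (intro continuous_intros) auto
qed

section \<open>Removing the regularization\<close>

context
  fixes \<beta> :: "nat \<Rightarrow> real" and \<rho> r :: "real \<Rightarrow> real" and \<kappa> :: real
  assumes \<beta>: "\<beta> \<in> seqs 2" and reg: "regularizing \<beta> \<rho> r \<kappa>"
begin

text \<open>For a dropped coordinate both sides are 0: the deformed entry is itself a division by
  zero, and so is its reciprocal.\<close>

lemma weight_deformed: "weight (kept \<beta> \<rho> \<Lambda>) (deformed \<beta> \<rho> \<Lambda>) j = 1 / deformed \<beta> \<rho> \<Lambda> j"
  by (simp add: weight_def kept_def deformed_def)

lemma rho_range: "\<Lambda> > 0 \<Longrightarrow> 0 \<le> \<rho> (sqrt (\<beta> j / \<Lambda>)) \<and> \<rho> (sqrt (\<beta> j / \<Lambda>)) \<le> 1"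
proof -
  assume "\<Lambda> > 0"
  then have "sqrt (\<beta> j / \<Lambda>) \<in> {0..}" using seqs_2D(1)[OF \<beta>, of j] by simp
  then show ?thesis using reg unfolding regularizing_def by (meson atLeastAtMost_iff image_subset_iff)
qed

lemma deformed_pos: "\<Lambda> > 0 \<Longrightarrow> \<forall>j\<in>kept \<beta> \<rho> \<Lambda>. deformed \<beta> \<rho> \<Lambda> j > 0"
  using rho_range seqs_2D(1)[OF \<beta>] by (force simp: kept_def deformed_def less_le)

text \<open>The reciprocal is \<open>\<rho>\<close> over \<open>\<beta> j\<close>, and
  \<open>\<rho>\<close> takes values between 0 and 1. The upper bound does not depend on the cutoff
  and supplies the domination when it is removed.\<close>

lemma inverse_deformed_bounds:
  assumes "\<Lambda> > 0"
  shows "0 \<le> 1 / deformed \<beta> \<rho> \<Lambda> j" "1 / deformed \<beta> \<rho> \<Lambda> j \<le> 1 / \<beta> j"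
  using rho_range[OF assms, of j] seqs_2D(1)[OF \<beta>, of j]
  by (auto simp: deformed_def intro!: divide_right_mono)

lemma inverse_deformed_tendsto: "((\<lambda>\<Lambda>. 1 / deformed \<beta> \<rho> \<Lambda> j) \<longlongrightarrow> 1 / \<beta> j) at_top"
proof -
  have "((\<lambda>\<Lambda>. sqrt (\<beta> j / \<Lambda>)) \<longlongrightarrow> sqrt 0) at_top"
    by (intro tendsto_real_sqrt tendsto_divide_0[OF tendsto_const] filterlim_at_top_imp_at_infinity filterlim_ident)
  moreover have "\<forall>\<^sub>F \<Lambda> in at_top. sqrt (\<beta> j / \<Lambda>) \<in> {0..}"
    using eventually_gt_at_top[of 0] by eventually_elim (use seqs_2D(1)[OF \<beta>, of j] in auto)
  ultimately have "((\<lambda>\<Lambda>. \<rho> (sqrt (\<beta> j / \<Lambda>))) \<longlongrightarrow> \<rho> (sqrt 0)) at_top"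
    using reg unfolding regularizing_def by (intro continuous_on_tendsto_compose[of "{0..}" \<rho>]) auto
  then have "((\<lambda>\<Lambda>. \<rho> (sqrt (\<beta> j / \<Lambda>))) \<longlongrightarrow> 1) at_top"
    using reg by (simp add: regularizing_def)
  from tendsto_divide[OF this tendsto_const, of "\<beta> j"] show ?thesis
    using seqs_2D(1)[OF \<beta>, of j] by (simp add: deformed_def)
qed

lemma eventually_summable_deformed:
  "\<forall>\<^sub>F \<Lambda> in at_top. \<Lambda> > 0 \<and> summable (\<lambda>j. 1 / deformed \<beta> \<rho> \<Lambda> j)"
  using reg by (intro eventually_conj eventually_gt_at_top) (auto simp: regularizing_def)

lemma summable_weight_deformed:
  assumes "\<Lambda> > 0" "summable (\<lambda>j. 1 / deformed \<beta> \<rho> \<Lambda> j)"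
  shows "summable (\<lambda>j. \<bar>weight (kept \<beta> \<rho> \<Lambda>) (deformed \<beta> \<rho> \<Lambda>) j\<bar>)"
  using assms(2) inverse_deformed_bounds(1)[OF assms(1)] unfolding weight_deformed
  by (simp only: abs_of_nonneg)

lemma summable_deformed_square:
  assumes "\<Lambda> > 0"
  shows "summable (\<lambda>j. (1 / deformed \<beta> \<rho> \<Lambda> j)\<^sup>2)"
proof (rule summable_comparison_test'[OF seqs_2D(2)[OF \<beta>]])
  show "norm ((1 / deformed \<beta> \<rho> \<Lambda> j)\<^sup>2) \<le> (1 / \<beta> j)\<^sup>2" for j
    using power_mono[OF inverse_deformed_bounds(2,1)[OF assms], of j 2] by simp
qed

text \<open>What the counterterm leaves of the divergent linear phase.\<close>

definition counterterm_gap :: "real \<Rightarrow> real \<Rightarrow> real" where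
  "counterterm_gap \<theta> \<Lambda> = (\<Sum>j. 1 / deformed \<beta> \<rho> \<Lambda> j) - (r \<Lambda> + \<theta>)"

lemma counterterm_gap_tendsto: "(counterterm_gap \<theta> \<longlongrightarrow> \<kappa> - \<theta>) at_top"
proof -
  have "(\<lambda>\<Lambda>. (\<Sum>j. 1 / deformed \<beta> \<rho> \<Lambda> j) - (r \<Lambda> + \<kappa>)) \<in> o[at_top](\<lambda>_. 1)"
    using reg by (simp add: regularizing_def)
  from tendsto_add[OF smalloD_tendsto[OF this] tendsto_const[of "\<kappa> - \<theta>"]] show ?thesis
    unfolding counterterm_gap_def[abs_def] by (simp add: algebra_simps)
qed

text \<open>At a finite cutoff the inverse entries are summable, so the linear phase can be split
  off the series of \<open>log_factor\<close> and merged with the counterterm.\<close>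

lemma Phi_shift_eq:
  assumes "\<Lambda> > 0" "summable (\<lambda>j. 1 / deformed \<beta> \<rho> \<Lambda> j)"
  shows "Phi_shift \<beta> \<rho> r \<theta> \<Lambda> = Phi_lim (deformed \<beta> \<rho> \<Lambda>) (counterterm_gap \<theta> \<Lambda>)"
proof
  fix s
  let ?x = "\<lambda>j. 1 / deformed \<beta> \<rho> \<Lambda> j"
  have "(\<lambda>j. log_factor_ren (s * ?x j)) sums (\<Sum>j. log_factor_ren (s * ?x j))"
    by (intro summable_sums summable_norm_cancel[OF summable_log_factor_ren] summable_deformed_square assms)
  moreover have "(\<lambda>j. \<i> * complex_of_real (s * ?x j / 2)) sums (\<i> * complex_of_real (s * (\<Sum>j. ?x j) / 2))"
    by (intro sums_mult sums_of_real sums_divide summable_sums assms)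
  ultimately have "(\<lambda>j. log_factor_ren (s * ?x j) + \<i> * complex_of_real (s * ?x j / 2)) sums
      ((\<Sum>j. log_factor_ren (s * ?x j)) + \<i> * complex_of_real (s * (\<Sum>j. ?x j) / 2))"
    by (rule sums_add)
  then have "(\<Sum>j. log_factor (s * ?x j)) = (\<Sum>j. log_factor_ren (s * ?x j)) + \<i> * complex_of_real (s * (\<Sum>j. ?x j) / 2)"
    unfolding log_factor_ren_eq by (simp add: sums_unique[symmetric])
  then have "Phi_reg \<beta> \<rho> \<Lambda> s = exp ((\<Sum>j. log_factor_ren (s * ?x j)) + \<i> * complex_of_real (s * (\<Sum>j. ?x j) / 2))"
    unfolding Phi_reg_def Phi_limit(3)[OF deformed_pos[OF assms(1)] summable_weight_deformed[OF assms]] weight_deformed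
    by simp
  then show "Phi_shift \<beta> \<rho> r \<theta> \<Lambda> s = Phi_lim (deformed \<beta> \<rho> \<Lambda>) (counterterm_gap \<theta> \<Lambda>) s"
    unfolding Phi_shift_def Phi_lim_def counterterm_gap_def
    by (simp add: exp_add[symmetric] right_diff_distrib diff_divide_distrib add_diff_eq)
qed

text \<open>Tannery's theorem: each term converges as the cutoff is removed, and all are dominated
  by \<open>s\<^sup>2 * (1 / \<beta> j)\<^sup>2\<close>.\<close>

lemma Phi_lim_deformed_tendsto:
  "((\<lambda>\<Lambda>. Phi_lim (deformed \<beta> \<rho> \<Lambda>) (counterterm_gap \<theta> \<Lambda>) s) \<longlongrightarrow> Phi_lim \<beta> (\<kappa> - \<theta>) s) at_top"
proof -
  have bound: "\<forall>\<^sub>F \<Lambda> in at_top. \<forall>j. norm (log_factor_ren (s * (1 / deformed \<beta> \<rho> \<Lambda> j))) \<le> s\<^sup>2 * (1 / \<beta> j)\<^sup>2"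
    using eventually_gt_at_top[of 0]
  proof (eventually_elim, intro allI)
    fix \<Lambda> :: real and j assume L: "0 < \<Lambda>"
    have "norm (log_factor_ren (s * (1 / deformed \<beta> \<rho> \<Lambda> j))) \<le> s\<^sup>2 * (1 / deformed \<beta> \<rho> \<Lambda> j)\<^sup>2"
      using norm_log_factor_ren_le[of "s * (1 / deformed \<beta> \<rho> \<Lambda> j)"] unfolding power_mult_distrib .
    also have "\<dots> \<le> s\<^sup>2 * (1 / \<beta> j)\<^sup>2"
      by (intro mult_left_mono power_mono inverse_deformed_bounds L) auto
    finally show "norm (log_factor_ren (s * (1 / deformed \<beta> \<rho> \<Lambda> j))) \<le> s\<^sup>2 * (1 / \<beta> j)\<^sup>2" .
  qed
  have "((\<lambda>\<Lambda>. \<Sum>j. log_factor_ren (s * (1 / deformed \<beta> \<rho> \<Lambda> j))) \<longlongrightarrow> (\<Sum>j. log_factor_ren (s * (1 / \<beta> j)))) at_top"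
  proof (rule tannerys_theorem[THEN conjunct2, THEN conjunct2])
    show "((\<lambda>\<Lambda>. log_factor_ren (s * (1 / deformed \<beta> \<rho> \<Lambda> j))) \<longlongrightarrow> log_factor_ren (s * (1 / \<beta> j))) at_top" for j
      by (intro isCont_tendsto_compose[OF isCont_log_factor_ren] tendsto_mult tendsto_const inverse_deformed_tendsto)
    show "\<forall>\<^sub>F (j, \<Lambda>) in at_top \<times>\<^sub>F at_top. norm (log_factor_ren (s * (1 / deformed \<beta> \<rho> \<Lambda> j))) \<le> s\<^sup>2 * (1 / \<beta> j)\<^sup>2"
      using eventually_prodI[OF eventually_True bound, of at_top] by eventually_elim auto
    show "summable (\<lambda>j. s\<^sup>2 * (1 / \<beta> j)\<^sup>2)" by (intro summable_mult seqs_2D(2)[OF \<beta>])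
  qed simp
  then show ?thesis
    unfolding Phi_lim_def by (intro tendsto_intros counterterm_gap_tendsto) auto
qed

lemma Phi_shift_tendsto: "((\<lambda>\<Lambda>. Phi_shift \<beta> \<rho> r \<theta> \<Lambda> s) \<longlongrightarrow> Phi_lim \<beta> (\<kappa> - \<theta>) s) at_top"
proof (rule Lim_transform_eventually[OF Phi_lim_deformed_tendsto])
  show "\<forall>\<^sub>F \<Lambda> in at_top. Phi_lim (deformed \<beta> \<rho> \<Lambda>) (counterterm_gap \<theta> \<Lambda>) s = Phi_shift \<beta> \<rho> r \<theta> \<Lambda> s"
    using eventually_summable_deformed by eventually_elim (simp add: Phi_shift_eq)
qed

lemma Phi_ren_eq: "Phi_ren \<beta> \<rho> r \<theta> = Phi_lim \<beta> (\<kappa> - \<theta>)"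
  unfolding Phi_ren_def[abs_def] by (intro ext tendsto_Lim Phi_shift_tendsto) simp

section \<open>The functions Z with and without cutoff, and the zeros in theta\<close>

context
  fixes lam :: real
  assumes lam: "lam > 0"
begin

lemma Z_reg_eq_T_op:
  assumes "\<Lambda> > 0" "summable (\<lambda>j. 1 / deformed \<beta> \<rho> \<Lambda> j)"
  shows "Z_exists (kept \<beta> \<rho> \<Lambda>) lam (deformed \<beta> \<rho> \<Lambda>)"
    and "T_exists (Phi_reg \<beta> \<rho> \<Lambda>) lam"
    and "complex_of_real (Z_reg lam \<beta> \<rho> \<Lambda>) = T_op (Phi_reg \<beta> \<rho> \<Lambda>) lam"
proof -
  note pos = deformed_pos[OF assms(1)]
  note lim = Z_gen_limit[OF lam pos summable_weight_deformed[OF assms], of 0]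
  show "Z_exists (kept \<beta> \<rho> \<Lambda>) lam (deformed \<beta> \<rho> \<Lambda>)"
    using integrable_Z_integrand[OF lam pos, where c = 0] lim(2) by (simp add: Z_exists_def Z_n_def)
  show "T_exists (Phi_reg \<beta> \<rho> \<Lambda>) lam"
    using lim(1) by (simp add: Phi_reg_def[abs_def])
  show "complex_of_real (Z_reg lam \<beta> \<rho> \<Lambda>) = T_op (Phi_reg \<beta> \<rho> \<Lambda>) lam"
    using lim(3) by (simp add: Phi_reg_def[abs_def] Z_reg_def Z_def Z_n_def)
qed

lemma ZN_eq_T_op:
  assumes "\<Lambda> > 0" "summable (\<lambda>j. 1 / deformed \<beta> \<rho> \<Lambda> j)"
  shows "ZN_exists lam \<beta> \<rho> r \<theta> \<Lambda>"
    and "T_exists (Phi_shift \<beta> \<rho> r \<theta> \<Lambda>) lam"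
    and "complex_of_real (ZN lam \<beta> \<rho> r \<theta> \<Lambda>) = T_op (Phi_shift \<beta> \<rho> r \<theta> \<Lambda>) lam"
proof -
  note pos = deformed_pos[OF assms(1)]
  note lim = Z_gen_limit[OF lam pos summable_weight_deformed[OF assms], of "r \<Lambda> + \<theta>"]
  have ren: "renormalized lam \<beta> \<rho> r \<theta> \<Lambda> = (\<lambda>j. deformed \<beta> \<rho> \<Lambda> j - lam * (r \<Lambda> + \<theta>))"
    by (auto simp: renormalized_def algebra_simps)
  show "ZN_exists lam \<beta> \<rho> r \<theta> \<Lambda>"
    unfolding ZN_exists_def ZN_n_def ren using integrable_Z_integrand[OF lam pos] lim(2) by auto
  show "T_exists (Phi_shift \<beta> \<rho> r \<theta> \<Lambda>) lam"
    using lim(1) unfolding Phi_shift_def[abs_def] Phi_reg_def .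
  show "complex_of_real (ZN lam \<beta> \<rho> r \<theta> \<Lambda>) = T_op (Phi_shift \<beta> \<rho> r \<theta> \<Lambda>) lam"
    using lim(3) unfolding Phi_shift_def[abs_def] Phi_reg_def ZN_def ZN_n_def ren .
qed

lemma T_exists_Phi_lim: "T_exists (Phi_lim \<beta> c) lam"
  by (rule T_exists_bounded[OF lam borel_measurable_Phi_lim norm_Phi_lim_le[OF seqs_2D(2)[OF \<beta>]]])

lemma ZN_tendsto:
  shows "((\<lambda>\<Lambda>. ZN lam \<beta> \<rho> r \<theta> \<Lambda>) \<longlongrightarrow> Z_ren lam \<beta> \<rho> r \<theta>) at_top"
    and "complex_of_real (Z_ren lam \<beta> \<rho> r \<theta>) = T_op (Phi_lim \<beta> (\<kappa> - \<theta>)) lam"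
proof -
  let ?T = "T_op (Phi_lim \<beta> (\<kappa> - \<theta>)) lam"
  \<comment> \<open>The limit is taken along \<open>Phi_lim\<close>, which is measurable for every
    value of the cutoff; the identification with \<open>ZN\<close> holds only eventually.\<close>
  have "((\<lambda>\<Lambda>. T_op (Phi_lim (deformed \<beta> \<rho> \<Lambda>) (counterterm_gap \<theta> \<Lambda>)) lam) \<longlongrightarrow> ?T) at_top"
  proof (rule T_op_tendsto_at_top[OF lam borel_measurable_Phi_lim borel_measurable_Phi_lim _ Phi_lim_deformed_tendsto])
    show "\<forall>\<^sub>F \<Lambda> in at_top. \<forall>s. norm (Phi_lim (deformed \<beta> \<rho> \<Lambda>) (counterterm_gap \<theta> \<Lambda>) s) \<le> 1"
      using eventually_gt_at_top[of 0]
      by eventually_elim (simp add: norm_Phi_lim_le[OF summable_deformed_square])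
  qed
  moreover have "\<forall>\<^sub>F \<Lambda> in at_top. T_op (Phi_lim (deformed \<beta> \<rho> \<Lambda>) (counterterm_gap \<theta> \<Lambda>)) lam =
      complex_of_real (ZN lam \<beta> \<rho> r \<theta> \<Lambda>)"
    using eventually_summable_deformed by eventually_elim (simp add: ZN_eq_T_op(3) Phi_shift_eq)
  ultimately have lim: "((\<lambda>\<Lambda>. complex_of_real (ZN lam \<beta> \<rho> r \<theta> \<Lambda>)) \<longlongrightarrow> ?T) at_top"
    by (rule Lim_transform_eventually)
  have Re: "((\<lambda>\<Lambda>. ZN lam \<beta> \<rho> r \<theta> \<Lambda>) \<longlongrightarrow> Re ?T) at_top"
    using tendsto_Re[OF lim] by simp
  have "((\<lambda>\<Lambda>::real. 0) \<longlongrightarrow> Im ?T) at_top"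
    using tendsto_Im[OF lim] by simp
  then have Im: "Im ?T = 0"
    using tendsto_unique[OF _ tendsto_const] by (metis trivial_limit_at_top_linorder)
  have "Z_ren lam \<beta> \<rho> r \<theta> = Re ?T"
    unfolding Z_ren_def using Re by (intro tendsto_Lim) auto
  with Re Im show "((\<lambda>\<Lambda>. ZN lam \<beta> \<rho> r \<theta> \<Lambda>) \<longlongrightarrow> Z_ren lam \<beta> \<rho> r \<theta>) at_top"
    and "complex_of_real (Z_ren lam \<beta> \<rho> r \<theta>) = ?T"
    by (auto simp: complex_eq_iff)
qed

lemma Z_ren_eq:
  "Z_ren lam \<beta> \<rho> r \<theta> = 1 / sqrt (4 * pi * lam) *
    (LINT s|lborel. exp (- s\<^sup>2 / (4 * lam)) * f_fun \<beta> s * cos (s * \<theta> / 2 + gr_fun \<kappa> \<beta> s / 2))"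
proof -
  have integrand: "Re (T_integrand (Phi_lim \<beta> (\<kappa> - \<theta>)) lam s) =
      exp (- s\<^sup>2 / (4 * lam)) * f_fun \<beta> s * cos (s * \<theta> / 2 + gr_fun \<kappa> \<beta> s / 2)" for s
  proof -
    have "Re (exp (- (\<i> / 2) * complex_of_real (s * \<theta> + gr_fun \<kappa> \<beta> s))) = cos (s * \<theta> / 2 + gr_fun \<kappa> \<beta> s / 2)"
      using cos_minus[of "s * \<theta> / 2 + gr_fun \<kappa> \<beta> s / 2"] by (simp add: Re_exp add_divide_distrib)
    then show ?thesis
      unfolding T_integrand_def Phi_lim_eq[OF \<beta>]
      by (simp only: times_complex.simps Re_complex_of_real Im_complex_of_real mult_zero_left diff_zero mult.assoc)
  qed
  have "Z_ren lam \<beta> \<rho> r \<theta> = Re (T_op (Phi_lim \<beta> (\<kappa> - \<theta>)) lam)"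
    using ZN_tendsto(2) by (metis Re_complex_of_real)
  also have "\<dots> = 1 / sqrt (4 * pi * lam) * Re (LINT s|lborel. T_integrand (Phi_lim \<beta> (\<kappa> - \<theta>)) lam s)"
    unfolding T_op_def by (simp only: times_complex.simps Re_complex_of_real Im_complex_of_real mult_zero_left diff_zero)
  also have "Re (LINT s|lborel. T_integrand (Phi_lim \<beta> (\<kappa> - \<theta>)) lam s) =
      (LINT s|lborel. Re (T_integrand (Phi_lim \<beta> (\<kappa> - \<theta>)) lam s))"
    using T_exists_Phi_lim by (intro integral_Re[symmetric]) (simp add: T_exists_def)
  finally show ?thesis unfolding integrand .
qed

text \<open>The parameter \<theta> enters \<open>Phi_lim\<close> only through the phase exp(-i s
  \<theta> / 2). So \<open>Z_ren\<close> is, up to a nonzero constant, the Fourier transform of the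
  fixed function \<open>h\<close> at -\<theta>/2, whose zeros form a countable and hence null
  set.\<close>

lemma AE_Z_ren_nonzero: "AE \<theta> in lborel. Z_ren lam \<beta> \<rho> r \<theta> \<noteq> 0"
proof -
  define h where "h = T_integrand (Phi_lim \<beta> \<kappa>) lam"
  let ?N = "{x::real. (LINT s|lborel. h s * exp (\<i> * of_real (x * s))) = 0}"
  have "countable ?N"
  proof (rule countable_fourier_zeros)
    show "h \<in> borel_measurable borel"
      unfolding h_def T_integrand_def[abs_def] by measurable
    show "norm (h s) \<le> exp (- (1 / (4 * lam) * s\<^sup>2))" for s
      using norm_Phi_lim_le[OF seqs_2D(2)[OF \<beta>], of \<kappa> s]
      by (simp add: h_def T_integrand_def norm_mult mult_left_le)
    show "isCont h 0"
      unfolding h_def T_integrand_def[abs_def] using lam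
      by (intro continuous_intros isCont_Phi_lim_0[OF \<beta>]) auto
    show "h 0 \<noteq> 0" by (simp add: h_def T_integrand_def Phi_lim_def)
  qed (use lam in auto)
  then have "countable {\<theta>::real. - (\<theta> / 2) \<in> ?N}"
    by (rule countable_image_inj) (auto intro: injI)
  then have "{\<theta>::real. - (\<theta> / 2) \<in> ?N} \<in> null_sets lborel"
    by (rule countable_imp_null_set_lborel)
  moreover have "{\<theta> \<in> space lborel. \<not> Z_ren lam \<beta> \<rho> r \<theta> \<noteq> 0} \<subseteq> {\<theta>::real. - (\<theta> / 2) \<in> ?N}"
  proof
    fix \<theta> assume "\<theta> \<in> {\<theta> \<in> space lborel. \<not> Z_ren lam \<beta> \<rho> r \<theta> \<noteq> 0}"
    then have "T_op (Phi_lim \<beta> (\<kappa> - \<theta>)) lam = 0"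
      using ZN_tendsto(2)[of \<theta>] by simp
    moreover have "T_integrand (Phi_lim \<beta> (\<kappa> - \<theta>)) lam s = h s * exp (\<i> * of_real (- (\<theta> / 2) * s))" for s
      unfolding h_def T_integrand_def Phi_lim_def
      by (simp add: mult.assoc exp_add[symmetric] right_diff_distrib diff_divide_distrib add_diff_eq mult.commute)
    ultimately show "\<theta> \<in> {\<theta>::real. - (\<theta> / 2) \<in> ?N}"
      using lam by (simp add: T_op_def)
  qed
  ultimately show ?thesis by (rule AE_I')
qed

end

end

theorem theorem2:
  fixes lam \<kappa> :: real and \<beta> :: "nat \<Rightarrow> real" and \<rho> r :: "real \<Rightarrow> real"
  assumes "lam > 0"
    and "\<beta> \<in> seqs 2 - seqs 1"
    and "regularizing \<beta> \<rho> r \<kappa>"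
  shows "(\<forall>\<theta>::real.
      (\<forall>\<^sub>F \<Lambda> in at_top.
         (\<forall>s. Phi_exists (kept \<beta> \<rho> \<Lambda>) s (deformed \<beta> \<rho> \<Lambda>)) \<and>
         (Z_exists (kept \<beta> \<rho> \<Lambda>) lam (deformed \<beta> \<rho> \<Lambda>) \<and>
          T_exists (Phi_reg \<beta> \<rho> \<Lambda>) lam \<and>
          complex_of_real (Z_reg lam \<beta> \<rho> \<Lambda>) = T_op (Phi_reg \<beta> \<rho> \<Lambda>) lam) \<and>
         (ZN_exists lam \<beta> \<rho> r \<theta> \<Lambda> \<and>
          T_exists (Phi_shift \<beta> \<rho> r \<theta> \<Lambda>) lam \<and>
          complex_of_real (ZN lam \<beta> \<rho> r \<theta> \<Lambda>) = T_op (Phi_shift \<beta> \<rho> r \<theta> \<Lambda>) lam)) \<and>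
      (\<forall>s. f_exists \<beta> s \<and> gr_exists \<beta> s \<and>
           ((\<lambda>\<Lambda>. Phi_shift \<beta> \<rho> r \<theta> \<Lambda> s) \<longlongrightarrow> Phi_ren \<beta> \<rho> r \<theta> s) at_top \<and>
           Phi_ren \<beta> \<rho> r \<theta> s =
             complex_of_real (f_fun \<beta> s) *
             exp (- (\<i> / 2) * complex_of_real (s * \<theta> + gr_fun \<kappa> \<beta> s))) \<and>
      ((\<lambda>\<Lambda>. ZN lam \<beta> \<rho> r \<theta> \<Lambda>) \<longlongrightarrow> Z_ren lam \<beta> \<rho> r \<theta>) at_top \<and>
      T_exists (Phi_ren \<beta> \<rho> r \<theta>) lam \<and>
      complex_of_real (Z_ren lam \<beta> \<rho> r \<theta>) = T_op (Phi_ren \<beta> \<rho> r \<theta>) lam \<and>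
      Z_ren lam \<beta> \<rho> r \<theta> =
        1 / sqrt (4 * pi * lam) *
        (LINT s|lborel. exp (- s\<^sup>2 / (4 * lam)) * f_fun \<beta> s * cos (s * \<theta> / 2 + gr_fun \<kappa> \<beta> s / 2))) \<and>
    (AE \<theta> in lborel. Z_ren lam \<beta> \<rho> r \<theta> \<noteq> 0)"
proof -
  have \<beta>: "\<beta> \<in> seqs 2" using assms(2) by simp
  note ctx = \<beta> assms(3)
  \<comment> \<open>A positive cutoff with summable inverse entries is the single condition behind
    all these claims, and it holds eventually.\<close>
  have ev: "\<forall>\<^sub>F \<Lambda> in at_top.
         (\<forall>s. Phi_exists (kept \<beta> \<rho> \<Lambda>) s (deformed \<beta> \<rho> \<Lambda>)) \<and>
         (Z_exists (kept \<beta> \<rho> \<Lambda>) lam (deformed \<beta> \<rho> \<Lambda>) \<and>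
          T_exists (Phi_reg \<beta> \<rho> \<Lambda>) lam \<and>
          complex_of_real (Z_reg lam \<beta> \<rho> \<Lambda>) = T_op (Phi_reg \<beta> \<rho> \<Lambda>) lam) \<and>
         (ZN_exists lam \<beta> \<rho> r \<theta> \<Lambda> \<and>
          T_exists (Phi_shift \<beta> \<rho> r \<theta> \<Lambda>) lam \<and>
          complex_of_real (ZN lam \<beta> \<rho> r \<theta> \<Lambda>) = T_op (Phi_shift \<beta> \<rho> r \<theta> \<Lambda>) lam)" for \<theta>
    using eventually_summable_deformed[OF ctx]
  proof eventually_elim
    case (elim \<Lambda>)
    then have L: "\<Lambda> > 0" "summable (\<lambda>j. 1 / deformed \<beta> \<rho> \<Lambda> j)" by auto
    have "Phi_exists (kept \<beta> \<rho> \<Lambda>) s (deformed \<beta> \<rho> \<Lambda>)" for s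
      by (rule Phi_limit(2)[OF deformed_pos[OF ctx L(1)] summable_weight_deformed[OF ctx L]])
    then show ?case
      using Z_reg_eq_T_op[OF ctx assms(1) L] ZN_eq_T_op[OF ctx assms(1) L] by blast
  qed
  note lim = Phi_shift_tendsto[OF ctx] and ren = Phi_ren_eq[OF ctx]
  show ?thesis
    unfolding ren
    by (intro conjI allI ev lim f_fun_eq(1)[OF \<beta>] gr_fun_eq(1)[OF \<beta>] Phi_lim_eq[OF \<beta>]
        ZN_tendsto[OF ctx assms(1)] T_exists_Phi_lim[OF ctx assms(1)] Z_ren_eq[OF ctx assms(1)]
        AE_Z_ren_nonzero[OF ctx assms(1)])
qed

end
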